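(* Let $\bar{\mathbb{F}}\in\{\mathbb{A},\ldots,\mathbb{Z}\}$ be one of the $26$ families listed in the context, with fixed admissible parameters, and let $B_{\bar{\mathbb{F}}}$ be the corresponding algebra. For every $i\in\{1,2\}$ and all integers $a,b\ge 0$ there exist unique coefficients $W_{\bar{\mathbb{F}},i}^{(a,b)}(\alpha,\beta;\ell)\in\Bbbk$ ($\alpha,\beta\ge 0$ integers, $\ell\in\{1,2\}$; only finitely many nonzero) such that \[ \mathrm{NF}_{\bar{\mathbb{F}}}(y_ix_1^ax_2^b)=\sum_{\alpha,\beta\ge0}\sum_{\ell=1}^{2}W_{\bar{\mathbb{F}},i}^{(a,b)}(\alpha,\beta;\ell)\,x_1^\alpha x_2^\beta y_\ell . \] They are determined by the initial conditions \[ W_{\bar{\mathbb{F}},i}^{(0,0)}(0,0;\ell)=\delta_{i,\ell},\qquad W_{\bar{\mathbb{F}},i}^{(0,0)}(\alpha,\beta;\ell)=0\ \text{ if }(\alpha,\beta)\neq(0,0), \] and by the following recursion. If $b>0$, set $(a',b',\varepsilon)=(a,b-1,2)$; if $b=0$ and $a>0$, set $(a',b',\varepsilon)=(a-1,0,1)$. Then, for $(a,b)\neq(0,0)$, \[ W_{\bar{\mathbb{F}},i}^{(a,b)}(\alpha,\beta;\ell)=\sum_{\mu,\nu\ge0}\sum_{j=1}^{2}W_{\bar{\mathbb{F}},i}^{(a',b')}(\mu,\nu;j)\sum_{(\lambda;t,\ell)\in\mathscr{K}_{j,\varepsilon}^{\bar{\mathbb{F}}}}\lambda\,\Omega_{\bar{\mathbb{F}}}(\mu,\nu;t;\alpha,\beta),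 \] where the innermost sum runs over those triples of $\mathscr{K}_{j,\varepsilon}^{\bar{\mathbb{F}}}$ whose last entry equals the given $\ell$.
   Context: **Ground field.** $\Bbbk$ is an algebraically closed field of characteristic zero; algebras are associative and unital. $\delta_{u,v}$ (with two subscripts) is the Kronecker delta. **The families.** Each family $\bar{\mathbb{F}}$ is given by scalars $(q_{\bar{\mathbb{F}}},r_{\bar{\mathbb{F}}})$, $(p_{\bar{\mathbb{F}}},s_{\bar{\mathbb{F}}})$ and finite sets $\mathscr{K}_{i,s}^{\bar{\mathbb{F}}}\subseteq\Bbbk\times\{1,2\}\times\{1,2\}$, $i,s\in\{1,2\}$, of triples $(\lambda;t,\ell)$. The algebra $B_{\bar{\mathbb{F}}}$ is generated by $x_1,x_2,y_1,y_2$ with the six defining relations \[ x_2x_1=q_{\bar{\mathbb{F}}}x_1x_2+r_{\bar{\mathbb{F}}}x_1^2,\quad y_2y_1=p_{\bar{\mathbb{F}}}y_1y_2+s_{\bar{\mathbb{F}}}y_1^2,\quad y_ix_s=\sum_{(\lambda;t,\ell)\in\mathscr{K}_{i,s}^{\bar{\mathbb{F}}}}\lambda\,x_ty_\ell\ \ (i,s\in\{1,2\}). \] Values of $(q_{\bar{\mathbb{F}}},r_{\bar{\mathbb{F}}})$; $(p_{\bar{\mathbb{F}}},s_{\bar{\mathbb{F}}})$: $\mathbb{A}$: $(1,0);(1,1)$. $\mathbb{B},\mathbb{C}$: $(p,0);(p,0)$. $\mathbb{D},\mathbb{E},\mathbb{F}$: $(-1,0);(p,0)$. $\mathbb{G}$: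 $(1,0);(p,0)$. $\mathbb{H}$: $(1,1);(-1,0)$. $\mathbb{I},\mathbb{J},\mathbb{K},\mathbb{L}$: $(q,0);(-1,0)$. $\mathbb{M},\mathbb{N},\mathbb{O},\mathbb{P},\mathbb{Q},\mathbb{R},\mathbb{S},\mathbb{T},\mathbb{U}$: $(-1,0);(-1,0)$. $\mathbb{V},\mathbb{W},\mathbb{X},\mathbb{Y}$: $(1,0);(-1,0)$. $\mathbb{Z}$: $(-1,0);(1,0)$. Sets $\mathscr{K}_{1,1}\mid\mathscr{K}_{1,2}\mid\mathscr{K}_{2,1}\mid\mathscr{K}_{2,2}$ in this order: - $\mathbb{A}$: $(1;1,1)\mid(1;2,1),(1;1,2)\mid(1;1,2)\mid(-2;2,1),(-1;1,2),(1;2,2)$ - $\mathbb{B}$: $(1;2,2)\mid(1;1,2)\mid(-1;2,1)\mid(1;1,1)$ - $\mathbb{C}$: $(-1;1,1),(p^2;2,1),(1;1,2),(-p;2,2)\mid(-p;1,1),(1;2,1),(1;1,2),(-p;2,2)\mid(-p;1,1),(-2p^2;2,1),(p;1,2),(-p;2,2)\mid(-p;1,1),(p^2;2,1),(1;1,2),(-1;2,2)$ - $\mathbb{D}$: $(-p;1,1)\mid(-p^2;2,1),(1;1,2)\mid(p;1,2)\mid(1;1,1),(1;2,2)$ - $\mathbb{E}$: $(1;1,2),(1;2,2)\mid(1;1,2),(-1;2,2)\mid(-1;1,1),(1;2,1)\mid(1;1,1),(1;2,1)$ - $\mathbb{F}$: $(-1;1,1),(-p;2,1),(1;1,2),(-1;2,2)\mid(-p;1,1),(1;2,1),(1;1,2),(1;2,2)\mid(-p;1,1),(p;2,1),(p;1,2),(1;2,2)\mid(-p;1,1),(-p;2,1),(1;1,2),(-p;2,2)$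 - $\mathbb{G}$: $(p;1,1)\mid(p;1,1),(p^2;2,1),(1;1,2)\mid(p;1,2)\mid(f;1,1),(-1;1,2),(1;2,2)$ - $\mathbb{H}$: $(1;1,2)\mid(f;1,2),(1;2,2)\mid(1;1,1)\mid(f;1,1),(1;2,1)$ - $\mathbb{I}$: $(-q;1,1),(-q;2,1),(1;1,2),(-q;2,2)\mid(1;1,1),(1;2,1),(1;1,2),(-q;2,2)\mid(1;1,1),(q;2,1),(q;1,2),(-q;2,2)\mid(-1;1,1),(-q;2,1),(1;1,2),(-1;2,2)$ - $\mathbb{J}$: $(1;2,1),(1;2,2)\mid(-1;1,1),(1;1,2)\mid(1;2,1),(-1;2,2)\mid(1;1,1),(1;1,2)$ - $\mathbb{K}$: $(1;1,1)\mid(1;2,2)\mid(1;1,2)\mid(f;2,1)$ - $\mathbb{L}$: $(f;1,2)\mid(1;2,2)\mid(f;1,1)\mid(1;2,1)$ - $\mathbb{M}$: $(1;2,1),(1;1,2)\mid(f;1,1),(-1;2,2)\mid(1;1,1),(-1;2,2)\mid(-1;2,1),(-f;1,2)$ - $\mathbb{N}$: $(-g;2,1),(f;2,2)\mid(g;1,1),(f;1,2)\mid(f;2,1),(-g;2,2)\mid(f;1,1),(g;1,2)$ - $\mathbb{O}$: $(1;1,1),(f;2,2)\mid(-1;2,1),(1;1,2)\mid(f;2,1),(-1;1,2)\mid(1;1,1),(1;2,2)$ - $\mathbb{P}$: $(1;1,2),(f;2,2)\mid(1;1,2),(1;2,2)\mid(1;1,1),(-f;2,1)\mid(-1;1,1),(1;2,1)$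 - $\mathbb{Q}$: $(1;1,2)\mid(1;1,1),(1;2,1),(1;1,2)\mid(-1;1,1)\mid(1;1,1),(-1;1,2),(1;2,2)$ - $\mathbb{R}$: $(1;1,1),(1;2,1),(1;1,2)\mid(1;1,2)\mid(1;2,1)\mid(-1;2,1),(-1;1,2),(1;2,2)$ - $\mathbb{S}$: $(-1;1,1),(1;2,1),(1;1,2),(1;2,2)\mid(1;1,1),(-1;2,1),(1;1,2),(1;2,2)\mid(1;1,1),(1;2,1),(-1;1,2),(1;2,2)\mid(1;1,1),(1;2,1),(1;1,2),(-1;2,2)$ - $\mathbb{T}$: $(-1;1,1),(1;2,1),(1;1,2),(1;2,2)\mid(1;1,1),(-1;2,1),(1;1,2),(1;2,2)\mid(1;1,1),(1;2,1),(1;1,2),(-1;2,2)\mid(1;1,1),(1;2,1),(-1;1,2),(1;2,2)$ - $\mathbb{U}$: $(-1;1,1),(1;2,1),(1;1,2),(1;2,2)\mid(1;1,1),(1;2,1),(1;1,2),(-1;2,2)\mid(1;1,1),(1;2,1),(-1;1,2),(1;2,2)\mid(1;1,1),(-1;2,1),(1;1,2),(1;2,2)$ - $\mathbb{V}$: $(1;2,1),(1;1,2)\mid(1;2,1)\mid(-1;1,1),(1;2,1)\mid(1;2,2)$ - $\mathbb{W}$: $(f;2,1),(1;1,2)\mid(1;1,1),(-1;2,2)\mid(1;1,1),(f;2,2)\mid(-1;2,1),(1;1,2)$ - $\mathbb{X}$: $(1;1,2)\mid(1;1,2),(1;2,2)\mid(1;1,1)\mid(1;1,1),(1;2,1)$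 - $\mathbb{Y}$: $(1;1,1)\mid(f;1,1),(-1;2,1),(1;1,2)\mid(1;1,2)\mid(1;1,1),(f;1,2),(-1;2,2)$ - $\mathbb{Z}$: $(1;1,1),(1;2,2)\mid(1;2,1),(1;1,2)\mid(f;2,1),(-1;1,2)\mid(f;1,1),(-1;2,2)$ **Admissible parameters.** The parameters $p,q,f,g\in\Bbbk$ occurring in a family are assumed to be such that $q_{\bar{\mathbb{F}}},p_{\bar{\mathbb{F}}}\neq0$ and $B_{\bar{\mathbb{F}}}$ is a trimmed double extension of $R=\Bbbk\{x_1,x_2\}/\langle x_2x_1-q_{\bar{\mathbb{F}}}x_1x_2-r_{\bar{\mathbb{F}}}x_1^2\rangle$ (via $x_s\mapsto x_s$). Here a trimmed double extension of $R$ is an algebra $B$ containing $R$ as a subalgebra, generated by $R$ and elements $y_1,y_2$, such that: $y_2y_1=p_{12}y_1y_2+p_{11}y_1^2$ with $p_{12}\in\Bbbk^\times,p_{11}\in\Bbbk$; $y_ir=\sum_{j=1}^2\sigma_{ij}(r)y_j$ for all $r\in R$, for some maps $\sigma_{ij}:R\to R$; $B$ is a free left $R$-module with basis $\{y_1^iy_2^j\}_{i,j\ge0}$ and a free right $R$-module with basis $\{y_2^iy_1^j\}_{i,j\ge0}$; and $y_1R+y_2R+R=Ry_1+Ry_2+R$. **Normal form.** Consequently the monomials $x_1^ax_2^by_1^cy_2^d$ ($a,b,c,d\ge0$) form a $\Bbbk$-basis of $B_{\bar{\mathbb{F}}}$, and $\mathrm{NF}_{\bar{\mathbb{F}}}(\omega)$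 denotes the unique (finite) expansion of the element represented by $\omega$ in this basis. **Coefficients.** For $q\in\Bbbk^\times$: $[n]_q:=1+q+\cdots+q^{n-1}$, $[0]_q:=0$; $\begin{bmatrix}0\\0\end{bmatrix}_q=1$, $\begin{bmatrix}n\\k\end{bmatrix}_q=0$ if $k<0$ or $k>n$, $\begin{bmatrix}n+1\\k\end{bmatrix}_q=\begin{bmatrix}n\\k-1\end{bmatrix}_q+q^k\begin{bmatrix}n\\k\end{bmatrix}_q$; $[m]_q^{\overline{k}}:=\prod_{j=0}^{k-1}[m+j]_q$; $\Lambda_{q,r}(n,m;k):=r^kq^{m(n-k)}\begin{bmatrix}n\\k\end{bmatrix}_q[m]_q^{\overline{k}}$, equal to $0$ if $k>n$ (with $0^0=1$). The array $\Omega_{\bar{\mathbb{F}}}$ is defined by $\mathrm{NF}_{\bar{\mathbb{F}}}(x_1^\mu x_2^\nu x_t)=\sum_{\alpha,\beta\ge0}\Omega_{\bar{\mathbb{F}}}(\mu,\nu;t;\alpha,\beta)x_1^\alpha x_2^\beta$; explicitly, \[ \Omega_{\bar{\mathbb{F}}}(\mu,\nu;2;\alpha,\beta)=\delta_{\alpha,\mu}\delta_{\beta,\nu+1},\qquad \Omega_{\bar{\mathbb{F}}}(\mu,\nu;1;\alpha,\beta)=\sum_{k=0}^{\nu}\Lambda_{q_{\bar{\mathbb{F}}},r_{\bar{\mathbb{F}}}}(\nu,1;k)\,\delta_{\alpha,\mu+1+k}\,\delta_{\beta,\nu-k}. \] *)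

theory Defs
  imports
    "HOL-Library.Poly_Mapping"
    "HOL-Computational_Algebra.Polynomial"
    "HOL-Algebra.Generated_Rings"
    "HOL-Algebra.QuotRing"
    "HOL-Algebra.Algebraic_Closure_Type"
begin

section \<open>Free algebras and presented algebras\<close>

text \<open>
  Words form a non-commutative additive monoid under concatenation, so that the convolution
  product of \<^type>\<open>poly_mapping\<close> makes \<open>'g word \<Rightarrow>\<^sub>0 'k\<close> the free associative unital
  \<open>'k\<close>-algebra on \<open>'g\<close>.
\<close>

datatype 'g word = Word "'g list"

instantiation word :: (type) monoid_add
begin

definition zero_word :: "'a word" where
  "0 = Word []"

fun plus_word :: "'a word \<Rightarrow> 'a word \<Rightarrow> 'a word" where
  "Word u + Word v = Word (u @ v)"

instance
proof
  fix a b c :: "'a word"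
  show "a + b + c = a + (b + c)" by (cases a; cases b; cases c) simp
  show "0 + a = a" "a + 0 = a" by (cases a; simp add: zero_word_def)+
qed

end

type_synonym ('g, 'k) free_alg = "'g word \<Rightarrow>\<^sub>0 'k"

definition gen :: "'g \<Rightarrow> ('g, 'k::field) free_alg" where
  "gen g = Poly_Mapping.single (Word [g]) 1"

definition scal :: "'k::field \<Rightarrow> ('g, 'k) free_alg" where
  "scal c = Poly_Mapping.single 0 c"

text \<open>
  A two-sided ring ideal of the free algebra is automatically a \<open>'k\<close>-subspace.
\<close>

definition rel_ideal :: "('g, 'k::field) free_alg set \<Rightarrow> ('g, 'k) free_alg set" where
  "rel_ideal S = Idl\<^bsub>ring_of_type_algebra\<^esub> S"

definition presented :: "('g, 'k::field) free_alg set \<Rightarrow> ('g, 'k) free_alg set ring" where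
  "presented S = ring_of_type_algebra Quot rel_ideal S"

definition cls :: "('g, 'k::field) free_alg set \<Rightarrow> ('g, 'k) free_alg \<Rightarrow> ('g, 'k) free_alg set" where
  "cls S u = rel_ideal S +>\<^bsub>ring_of_type_algebra\<^esub> u"


section \<open>Trimmed double extensions\<close>

datatype idx = I1 | I2

text \<open>
  An associative unital \<open>'k\<close>-algebra is a ring \<open>B\<close> with a structure map \<open>\<eta>\<close> from \<open>'k\<close>
  into its centre.
\<close>

definition k_algebra :: "('b, 'm) ring_scheme \<Rightarrow> ('k::field \<Rightarrow> 'b) \<Rightarrow> bool" where
  "k_algebra B \<eta> \<longleftrightarrow> ring B \<and> \<eta> \<in> ring_hom ring_of_type_algebra B \<and>
     (\<forall>c. \<forall>b\<in>carrier B. \<eta> c \<otimes>\<^bsub>B\<^esub> b = b \<otimes>\<^bsub>B\<^esub> \<eta> c)"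

definition k_subalgebra :: "('b, 'm) ring_scheme \<Rightarrow> ('k::field \<Rightarrow> 'b) \<Rightarrow> 'b set \<Rightarrow> bool" where
  "k_subalgebra B \<eta> R \<longleftrightarrow> subring R B \<and> range \<eta> \<subseteq> R"

definition free_left_basis :: "('b, 'm) ring_scheme \<Rightarrow> 'b set \<Rightarrow> ('n \<Rightarrow> 'b) \<Rightarrow> bool" where
  "free_left_basis B R e \<longleftrightarrow> range e \<subseteq> carrier B \<and>
     (\<forall>b\<in>carrier B. \<exists>!c. range c \<subseteq> R \<and> finite {n. c n \<noteq> \<zero>\<^bsub>B\<^esub>} \<and>
        b = (\<Oplus>\<^bsub>B\<^esub>n\<in>{n. c n \<noteq> \<zero>\<^bsub>B\<^esub>}. c n \<otimes>\<^bsub>B\<^esub> e n))"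

definition free_right_basis :: "('b, 'm) ring_scheme \<Rightarrow> 'b set \<Rightarrow> ('n \<Rightarrow> 'b) \<Rightarrow> bool" where
  "free_right_basis B R e \<longleftrightarrow> range e \<subseteq> carrier B \<and>
     (\<forall>b\<in>carrier B. \<exists>!c. range c \<subseteq> R \<and> finite {n. c n \<noteq> \<zero>\<^bsub>B\<^esub>} \<and>
        b = (\<Oplus>\<^bsub>B\<^esub>n\<in>{n. c n \<noteq> \<zero>\<^bsub>B\<^esub>}. e n \<otimes>\<^bsub>B\<^esub> c n))"

definition trimmed_double_extension ::
    "('b, 'm) ring_scheme \<Rightarrow> ('k::field \<Rightarrow> 'b) \<Rightarrow> 'b set \<Rightarrow> 'b \<Rightarrow> 'b \<Rightarrow> bool" where
  "trimmed_double_extension B \<eta> R y1 y2 \<longleftrightarrow>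
     k_algebra B \<eta> \<and> k_subalgebra B \<eta> R \<and> y1 \<in> carrier B \<and> y2 \<in> carrier B \<and>
     generate_ring B (R \<union> {y1, y2}) = carrier B \<and>
     (\<exists>p12 p11. p12 \<noteq> 0 \<and>
        y2 \<otimes>\<^bsub>B\<^esub> y1 = \<eta> p12 \<otimes>\<^bsub>B\<^esub> (y1 \<otimes>\<^bsub>B\<^esub> y2) \<oplus>\<^bsub>B\<^esub> \<eta> p11 \<otimes>\<^bsub>B\<^esub> (y1 \<otimes>\<^bsub>B\<^esub> y1)) \<and>
     (\<exists>\<sigma>11 \<sigma>12 \<sigma>21 \<sigma>22.
        \<sigma>11 \<in> R \<rightarrow> R \<and> \<sigma>12 \<in> R \<rightarrow> R \<and> \<sigma>21 \<in> R \<rightarrow> R \<and> \<sigma>22 \<in> R \<rightarrow> R \<and>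
        (\<forall>r\<in>R. y1 \<otimes>\<^bsub>B\<^esub> r = \<sigma>11 r \<otimes>\<^bsub>B\<^esub> y1 \<oplus>\<^bsub>B\<^esub> \<sigma>12 r \<otimes>\<^bsub>B\<^esub> y2 \<and>
               y2 \<otimes>\<^bsub>B\<^esub> r = \<sigma>21 r \<otimes>\<^bsub>B\<^esub> y1 \<oplus>\<^bsub>B\<^esub> \<sigma>22 r \<otimes>\<^bsub>B\<^esub> y2)) \<and>
     free_left_basis B R (\<lambda>(i, j). y1 [^]\<^bsub>B\<^esub> (i::nat) \<otimes>\<^bsub>B\<^esub> y2 [^]\<^bsub>B\<^esub> (j::nat)) \<and>
     free_right_basis B R (\<lambda>(i, j). y2 [^]\<^bsub>B\<^esub> (i::nat) \<otimes>\<^bsub>B\<^esub> y1 [^]\<^bsub>B\<^esub> (j::nat)) \<and>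
     {y1 \<otimes>\<^bsub>B\<^esub> r \<oplus>\<^bsub>B\<^esub> y2 \<otimes>\<^bsub>B\<^esub> r' \<oplus>\<^bsub>B\<^esub> r'' | r r' r''. r \<in> R \<and> r' \<in> R \<and> r'' \<in> R} =
     {r \<otimes>\<^bsub>B\<^esub> y1 \<oplus>\<^bsub>B\<^esub> r' \<otimes>\<^bsub>B\<^esub> y2 \<oplus>\<^bsub>B\<^esub> r'' | r r' r''. r \<in> R \<and> r' \<in> R \<and> r'' \<in> R}"


section \<open>The 26 families\<close>

text \<open>Each constructor carries exactly the parameters occurring in its family.\<close>

datatype 'k family =
    FamA | FamB 'k | FamC 'k | FamD 'k | FamE 'k | FamF 'k
  | FamG 'k 'k | FamH 'k | FamI 'k | FamJ 'k | FamK 'k 'k | FamL 'k 'k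
  | FamM 'k | FamN 'k 'k | FamO 'k | FamP 'k | FamQ | FamR
  | FamS | FamT | FamU | FamV | FamW 'k | FamX
  | FamY 'k | FamZ 'k

primrec parameters :: "'k::field family \<Rightarrow> ('k \<times> 'k) \<times> ('k \<times> 'k)" where
  "parameters FamA = ((1, 0), (1, 1))"
| "parameters (FamB p) = ((p, 0), (p, 0))"
| "parameters (FamC p) = ((p, 0), (p, 0))"
| "parameters (FamD p) = ((-1, 0), (p, 0))"
| "parameters (FamE p) = ((-1, 0), (p, 0))"
| "parameters (FamF p) = ((-1, 0), (p, 0))"
| "parameters (FamG p f) = ((1, 0), (p, 0))"
| "parameters (FamH f) = ((1, 1), (-1, 0))"
| "parameters (FamI q) = ((q, 0), (-1, 0))"
| "parameters (FamJ q) = ((q, 0), (-1, 0))"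
| "parameters (FamK q f) = ((q, 0), (-1, 0))"
| "parameters (FamL q f) = ((q, 0), (-1, 0))"
| "parameters (FamM f) = ((-1, 0), (-1, 0))"
| "parameters (FamN f g) = ((-1, 0), (-1, 0))"
| "parameters (FamO f) = ((-1, 0), (-1, 0))"
| "parameters (FamP f) = ((-1, 0), (-1, 0))"
| "parameters FamQ = ((-1, 0), (-1, 0))"
| "parameters FamR = ((-1, 0), (-1, 0))"
| "parameters FamS = ((-1, 0), (-1, 0))"
| "parameters FamT = ((-1, 0), (-1, 0))"
| "parameters FamU = ((-1, 0), (-1, 0))"
| "parameters FamV = ((1, 0), (-1, 0))"
| "parameters (FamW f) = ((1, 0), (-1, 0))"
| "parameters FamX = ((1, 0), (-1, 0))"
| "parameters (FamY f) = ((1, 0), (-1, 0))"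
| "parameters (FamZ f) = ((-1, 0), (1, 0))"

text \<open>\<open>parameters F = ((q, r), (p, s))\<close>\<close>

abbreviation q_par :: "'k::field family \<Rightarrow> 'k" where "q_par F \<equiv> fst (fst (parameters F))"
abbreviation r_par :: "'k::field family \<Rightarrow> 'k" where "r_par F \<equiv> snd (fst (parameters F))"
abbreviation p_par :: "'k::field family \<Rightarrow> 'k" where "p_par F \<equiv> fst (snd (parameters F))"
abbreviation s_par :: "'k::field family \<Rightarrow> 'k" where "s_par F \<equiv> snd (snd (parameters F))"

fun table :: "'a \<Rightarrow> 'a \<Rightarrow> 'a \<Rightarrow> 'a \<Rightarrow> idx \<Rightarrow> idx \<Rightarrow> 'a" where
  "table k11 k12 k21 k22 I1 I1 = k11"
| "table k11 k12 k21 k22 I1 I2 = k12"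
| "table k11 k12 k21 k22 I2 I1 = k21"
| "table k11 k12 k21 k22 I2 I2 = k22"

text \<open>
  \<open>mixed_terms F i s\<close> is the set of triples \<open>(\<lambda>, t, \<ell>)\<close> with
  \<open>y\<^sub>i x\<^sub>s = \<Sum> \<lambda> x\<^sub>t y\<^sub>\<ell>\<close>.
\<close>

primrec mixed_terms ::
  "'k::field family \<Rightarrow> idx \<Rightarrow> idx \<Rightarrow> ('k \<times> idx \<times> idx) set" where
  "mixed_terms FamA = table
    {(1, I1, I1)}
    {(1, I2, I1), (1, I1, I2)}
    {(1, I1, I2)}
    {(-2, I2, I1), (-1, I1, I2), (1, I2, I2)}"
| "mixed_terms (FamB p) = table
    {(1, I2, I2)}
    {(1, I1, I2)}
    {(-1, I2, I1)}
    {(1, I1, I1)}"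
| "mixed_terms (FamC p) = table
    {(-1, I1, I1), (p^2, I2, I1), (1, I1, I2), (-p, I2, I2)}
    {(-p, I1, I1), (1, I2, I1), (1, I1, I2), (-p, I2, I2)}
    {(-p, I1, I1), (-2 * p^2, I2, I1), (p, I1, I2), (-p, I2, I2)}
    {(-p, I1, I1), (p^2, I2, I1), (1, I1, I2), (-1, I2, I2)}"
| "mixed_terms (FamD p) = table
    {(-p, I1, I1)}
    {(- (p^2), I2, I1), (1, I1, I2)}
    {(p, I1, I2)}
    {(1, I1, I1), (1, I2, I2)}"
| "mixed_terms (FamE p) = table
    {(1, I1, I2), (1, I2, I2)}
    {(1, I1, I2), (-1, I2, I2)}
    {(-1, I1, I1), (1, I2, I1)}
    {(1, I1, I1), (1, I2, I1)}"
| "mixed_terms (FamF p) = table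
    {(-1, I1, I1), (-p, I2, I1), (1, I1, I2), (-1, I2, I2)}
    {(-p, I1, I1), (1, I2, I1), (1, I1, I2), (1, I2, I2)}
    {(-p, I1, I1), (p, I2, I1), (p, I1, I2), (1, I2, I2)}
    {(-p, I1, I1), (-p, I2, I1), (1, I1, I2), (-p, I2, I2)}"
| "mixed_terms (FamG p f) = table
    {(p, I1, I1)}
    {(p, I1, I1), (p^2, I2, I1), (1, I1, I2)}
    {(p, I1, I2)}
    {(f, I1, I1), (-1, I1, I2), (1, I2, I2)}"
| "mixed_terms (FamH f) = table
    {(1, I1, I2)}
    {(f, I1, I2), (1, I2, I2)}
    {(1, I1, I1)}
    {(f, I1, I1), (1, I2, I1)}"
| "mixed_terms (FamI q) = table
    {(-q, I1, I1), (-q, I2, I1), (1, I1, I2), (-q, I2, I2)}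
    {(1, I1, I1), (1, I2, I1), (1, I1, I2), (-q, I2, I2)}
    {(1, I1, I1), (q, I2, I1), (q, I1, I2), (-q, I2, I2)}
    {(-1, I1, I1), (-q, I2, I1), (1, I1, I2), (-1, I2, I2)}"
| "mixed_terms (FamJ q) = table
    {(1, I2, I1), (1, I2, I2)}
    {(-1, I1, I1), (1, I1, I2)}
    {(1, I2, I1), (-1, I2, I2)}
    {(1, I1, I1), (1, I1, I2)}"
| "mixed_terms (FamK q f) = table
    {(1, I1, I1)}
    {(1, I2, I2)}
    {(1, I1, I2)}
    {(f, I2, I1)}"
| "mixed_terms (FamL q f) = table
    {(f, I1, I2)}
    {(1, I2, I2)}
    {(f, I1, I1)}
    {(1, I2, I1)}"
| "mixed_terms (FamM f) = table
    {(1, I2, I1), (1, I1, I2)}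
    {(f, I1, I1), (-1, I2, I2)}
    {(1, I1, I1), (-1, I2, I2)}
    {(-1, I2, I1), (-f, I1, I2)}"
| "mixed_terms (FamN f g) = table
    {(-g, I2, I1), (f, I2, I2)}
    {(g, I1, I1), (f, I1, I2)}
    {(f, I2, I1), (-g, I2, I2)}
    {(f, I1, I1), (g, I1, I2)}"
| "mixed_terms (FamO f) = table
    {(1, I1, I1), (f, I2, I2)}
    {(-1, I2, I1), (1, I1, I2)}
    {(f, I2, I1), (-1, I1, I2)}
    {(1, I1, I1), (1, I2, I2)}"
| "mixed_terms (FamP f) = table
    {(1, I1, I2), (f, I2, I2)}
    {(1, I1, I2), (1, I2, I2)}
    {(1, I1, I1), (-f, I2, I1)}
    {(-1, I1, I1), (1, I2, I1)}"
| "mixed_terms FamQ = table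
    {(1, I1, I2)}
    {(1, I1, I1), (1, I2, I1), (1, I1, I2)}
    {(-1, I1, I1)}
    {(1, I1, I1), (-1, I1, I2), (1, I2, I2)}"
| "mixed_terms FamR = table
    {(1, I1, I1), (1, I2, I1), (1, I1, I2)}
    {(1, I1, I2)}
    {(1, I2, I1)}
    {(-1, I2, I1), (-1, I1, I2), (1, I2, I2)}"
| "mixed_terms FamS = table
    {(-1, I1, I1), (1, I2, I1), (1, I1, I2), (1, I2, I2)}
    {(1, I1, I1), (-1, I2, I1), (1, I1, I2), (1, I2, I2)}
    {(1, I1, I1), (1, I2, I1), (-1, I1, I2), (1, I2, I2)}
    {(1, I1, I1), (1, I2, I1), (1, I1, I2), (-1, I2, I2)}"
| "mixed_terms FamT = table
    {(-1, I1, I1), (1, I2, I1), (1, I1, I2), (1, I2, I2)}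
    {(1, I1, I1), (-1, I2, I1), (1, I1, I2), (1, I2, I2)}
    {(1, I1, I1), (1, I2, I1), (1, I1, I2), (-1, I2, I2)}
    {(1, I1, I1), (1, I2, I1), (-1, I1, I2), (1, I2, I2)}"
| "mixed_terms FamU = table
    {(-1, I1, I1), (1, I2, I1), (1, I1, I2), (1, I2, I2)}
    {(1, I1, I1), (1, I2, I1), (1, I1, I2), (-1, I2, I2)}
    {(1, I1, I1), (1, I2, I1), (-1, I1, I2), (1, I2, I2)}
    {(1, I1, I1), (-1, I2, I1), (1, I1, I2), (1, I2, I2)}"
| "mixed_terms FamV = table
    {(1, I2, I1), (1, I1, I2)}
    {(1, I2, I1)}
    {(-1, I1, I1), (1, I2, I1)}
    {(1, I2, I2)}"
| "mixed_terms (FamW f) = table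
    {(f, I2, I1), (1, I1, I2)}
    {(1, I1, I1), (-1, I2, I2)}
    {(1, I1, I1), (f, I2, I2)}
    {(-1, I2, I1), (1, I1, I2)}"
| "mixed_terms FamX = table
    {(1, I1, I2)}
    {(1, I1, I2), (1, I2, I2)}
    {(1, I1, I1)}
    {(1, I1, I1), (1, I2, I1)}"
| "mixed_terms (FamY f) = table
    {(1, I1, I1)}
    {(f, I1, I1), (-1, I2, I1), (1, I1, I2)}
    {(1, I1, I2)}
    {(1, I1, I1), (f, I1, I2), (-1, I2, I2)}"
| "mixed_terms (FamZ f) = table
    {(1, I1, I1), (1, I2, I2)}
    {(1, I2, I1), (1, I1, I2)}
    {(f, I2, I1), (-1, I1, I2)}
    {(f, I1, I1), (-1, I2, I2)}"


datatype var = VX idx | VY idx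

abbreviation xv :: "idx \<Rightarrow> (var, 'k::field) free_alg" where "xv t \<equiv> gen (VX t)"
abbreviation yv :: "idx \<Rightarrow> (var, 'k::field) free_alg" where "yv l \<equiv> gen (VY l)"

definition B_rels :: "'k::field family \<Rightarrow> (var, 'k) free_alg set" where
  "B_rels F =
     {xv I2 * xv I1 - (scal (q_par F) * xv I1 * xv I2 + scal (r_par F) * xv I1 ^ 2),
      yv I2 * yv I1 - (scal (p_par F) * yv I1 * yv I2 + scal (s_par F) * yv I1 ^ 2)}
     \<union> {yv i * xv s - (\<Sum>(c, t, l)\<in>mixed_terms F i s. scal c * xv t * yv l) | i s. True}"

definition R_rels :: "'k::field family \<Rightarrow> (idx, 'k) free_alg set" where
  "R_rels F =
     {gen I2 * gen I1 - (scal (q_par F) * gen I1 * gen I2 + scal (r_par F) * gen I1 ^ 2)}"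

text \<open>
  The clause on \<open>\<phi>\<close> makes \<open>R\<close> a subalgebra of \<open>B\<^sub>F\<close> via \<open>x\<^sub>s \<mapsto> x\<^sub>s\<close>: these values determine
  the algebra homomorphism \<open>\<phi>\<close>.  The elements \<open>y\<^sub>1, y\<^sub>2\<close> of the extension are the generators of \<open>B\<^sub>F\<close>.
\<close>

definition admissible :: "'k::field family \<Rightarrow> bool" where
  "admissible F \<longleftrightarrow> q_par F \<noteq> 0 \<and> p_par F \<noteq> 0 \<and>
     (\<exists>\<phi>. \<phi> \<in> ring_hom (presented (R_rels F)) (presented (B_rels F)) \<and>
          (\<forall>c. \<phi> (cls (R_rels F) (scal c)) = cls (B_rels F) (scal c)) \<and>
          (\<forall>s. \<phi> (cls (R_rels F) (gen s)) = cls (B_rels F) (xv s)) \<and>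
          inj_on \<phi> (carrier (presented (R_rels F))) \<and>
          trimmed_double_extension (presented (B_rels F)) (\<lambda>c. cls (B_rels F) (scal c))
            (\<phi> ` carrier (presented (R_rels F))) (cls (B_rels F) (yv I1)) (cls (B_rels F) (yv I2)))"


section \<open>Normal forms\<close>

text \<open>
  Finite linear combinations of the words \<open>x\<^sub>1\<^sup>a x\<^sub>2\<^sup>b y\<^sub>1\<^sup>c y\<^sub>2\<^sup>d\<close>, as elements of the free algebra
  (where these words are linearly independent, so an element determines its coefficients).  The sum \<^const>\<open>Sum_any\<close> ranges over the
  support of the summand.
\<close>

definition normal_span :: "(var, 'k::field) free_alg set" where
  "normal_span =
     {Sum_any (\<lambda>(a, b, c, d). scal (h a b c d) * xv I1 ^ a * xv I2 ^ b * yv I1 ^ c * yv I2 ^ d) | h.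
        finite {(a, b, c, d). h a b c d \<noteq> 0}}"

definition NF :: "'k::field family \<Rightarrow> (var, 'k) free_alg \<Rightarrow> (var, 'k) free_alg" where
  "NF F \<omega> = (THE u. u \<in> normal_span \<and> cls (B_rels F) u = cls (B_rels F) \<omega>)"


section \<open>Coefficients\<close>

definition qnum :: "'k::field \<Rightarrow> nat \<Rightarrow> 'k" where
  "qnum q n = (\<Sum>j<n. q ^ j)"

text \<open>The first clause of the \<open>Suc\<close> case is the recursion with \<open>k = 0\<close>, where the \<open>k - 1\<close> term is 0.\<close>

fun qbinom :: "'k::field \<Rightarrow> nat \<Rightarrow> nat \<Rightarrow> 'k" where
  "qbinom q 0 0 = 1"
| "qbinom q 0 (Suc k) = 0"
| "qbinom q (Suc n) 0 = q ^ 0 * qbinom q n 0"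
| "qbinom q (Suc n) (Suc k) = qbinom q n k + q ^ Suc k * qbinom q n (Suc k)"

definition qrising :: "'k::field \<Rightarrow> nat \<Rightarrow> nat \<Rightarrow> 'k" where
  "qrising q m k = (\<Prod>j<k. qnum q (m + j))"

definition Lambda :: "'k::field \<Rightarrow> 'k \<Rightarrow> nat \<Rightarrow> nat \<Rightarrow> nat \<Rightarrow> 'k" where
  "Lambda q r n m k =
     (if k > n then 0 else r ^ k * q ^ (m * (n - k)) * qbinom q n k * qrising q m k)"

text \<open>
  \<open>Omega\<close> is given by its explicit values; the lemma \<open>Omega_expansion\<close> below is the
  expansion of \<open>x\<^sub>1\<^sup>\<mu> x\<^sub>2\<^sup>\<nu> x\<^sub>t\<close> that characterizes it.
\<close>

definition Omega :: "'k::field family \<Rightarrow> nat \<Rightarrow> nat \<Rightarrow> idx \<Rightarrow> nat \<Rightarrow> nat \<Rightarrow> 'k" where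
  "Omega F \<mu> \<nu> t \<alpha> \<beta> =
     (case t of
        I2 \<Rightarrow> of_bool (\<alpha> = \<mu>) * of_bool (\<beta> = \<nu> + 1)
      | I1 \<Rightarrow> (\<Sum>k\<le>\<nu>. Lambda (q_par F) (r_par F) \<nu> 1 k *
                of_bool (\<alpha> = \<mu> + 1 + k) * of_bool (\<beta> = \<nu> - k)))"

lemma ring_free_alg: "ring (ring_of_type_algebra :: 'a::ring_1 ring)"
proof -
  have "\<exists>y. x + y = 0" for x :: 'a
    using add.right_inverse by blast
  thus ?thesis
    unfolding ring_of_type_algebra_def using add.right_inverse
    by unfold_locales (auto simp: algebra_simps Units_def)
qed

lemma ideal_rel_ideal: "ideal (rel_ideal S) ring_of_type_algebra"
  unfolding rel_ideal_def
  by (rule ring.genideal_ideal[OF ring_free_alg]) (simp add: ring_of_type_algebra_def)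

lemma rel_ideal_incl: "S \<subseteq> rel_ideal S"
  unfolding rel_ideal_def
  by (rule ring.genideal_self[OF ring_free_alg]) (simp add: ring_of_type_algebra_def)

lemma rel_ideal_add: "u \<in> rel_ideal S \<Longrightarrow> v \<in> rel_ideal S \<Longrightarrow> u + v \<in> rel_ideal S"
  using additive_subgroup.a_closed[OF ideal.axioms(1)[OF ideal_rel_ideal[of S]], of u v]
  by (simp add: ring_of_type_algebra_def)

lemma rel_ideal_zero: "0 \<in> rel_ideal S"
  using additive_subgroup.zero_closed[OF ideal.axioms(1)[OF ideal_rel_ideal[of S]]]
  by (simp add: ring_of_type_algebra_def)

lemma rel_ideal_lmult: "u \<in> rel_ideal S \<Longrightarrow> v * u \<in> rel_ideal S"
  using ideal.I_l_closed[OF ideal_rel_ideal[of S], of u v]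
  by (simp add: ring_of_type_algebra_def)

lemma rel_ideal_rmult: "u \<in> rel_ideal S \<Longrightarrow> u * v \<in> rel_ideal S"
  using ideal.I_r_closed[OF ideal_rel_ideal[of S], of u v]
  by (simp add: ring_of_type_algebra_def)

lemma cls_eqI:
  assumes "u - v \<in> rel_ideal S"
  shows "cls S u = cls S v"
proof -
  have "cls S w = {i + w | i. i \<in> rel_ideal S}" for w
    by (auto simp: cls_def a_r_coset_def' ring_of_type_algebra_def)
  moreover have "v - u \<in> rel_ideal S"
    using rel_ideal_lmult[OF assms, of "-1"] by simp
  then have "\<exists>i'\<in>rel_ideal S. i + v = i' + u" if "i \<in> rel_ideal S" for i
    using that rel_ideal_add[of i S "v - u"] by (intro bexI[of _ "i + (v - u)"]) auto
  moreover have "\<exists>i'\<in>rel_ideal S. i + u = i' + v" if "i \<in> rel_ideal S" for i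
    using that assms rel_ideal_add[of i S "u - v"] by (intro bexI[of _ "i + (u - v)"]) auto
  ultimately show ?thesis by auto blast+
qed

lemma scal_add: "scal (c + d) = scal c + scal d"
  and scal_mult: "scal (c * d) = scal c * scal d"
  and scal_one: "scal 1 = 1"
  and scal_zero: "scal 0 = 0"
  by (simp_all add: scal_def single_add mult_single)

lemma scal_gen_commute: "scal c * gen g = gen g * scal c"
  by (simp add: scal_def gen_def mult_single)

lemma scal_pow_commute: "scal c * gen g ^ n = gen g ^ n * scal c"
  by (rule power_commuting_commutes[symmetric]) (simp add: scal_gen_commute)

lemma qbinom_eq_0: "n < k \<Longrightarrow> qbinom q n k = 0"
  by (induction q n k rule: qbinom.induct) auto

lemma qnum_Suc: "qnum q (Suc n) = qnum q n + q ^ n"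
  by (simp add: qnum_def)

lemma Lambda_Suc:
  "Lambda q r (Suc n) 1 k =
     Lambda q r n 1 k * q ^ Suc k + (case k of 0 \<Rightarrow> 0 | Suc k' \<Rightarrow> Lambda q r n 1 k' * r * qnum q k)"
proof (cases k)
  case 0
  then show ?thesis by (simp add: Lambda_def)
next
  case (Suc k')
  consider "k \<le> n" | "k = Suc n" | "k > Suc n" by linarith
  then show ?thesis
  proof cases
    case 1
    with Suc have e: "q ^ (n - k') = q ^ (n - k) * q"
      by (metis Suc_diff_Suc Suc_le_lessD power_Suc2)
    from 1 Suc show ?thesis
      by (simp add: Lambda_def qrising_def e algebra_simps power_add)
  next
    case 2
    with Suc show ?thesis
      by (simp add: Lambda_def qrising_def qbinom_eq_0 algebra_simps)
  qed (use Suc in \<open>simp add: Lambda_def\<close>)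
qed

lemma x2_x1_pow:
  fixes F :: "'k::field family"
  shows "xv I2 * xv I1 ^ m - (scal (q_par F ^ m) * xv I1 ^ m * xv I2
           + scal (r_par F * qnum (q_par F) m) * xv I1 ^ Suc m) \<in> rel_ideal (B_rels F)"
proof (induction m)
  case 0
  then show ?case by (simp add: qnum_def scal_zero scal_one rel_ideal_zero)
next
  case (Suc m)
  let ?q = "q_par F" and ?r = "r_par F"
  let ?d = "xv I2 * xv I1 ^ m - (scal (?q ^ m) * xv I1 ^ m * xv I2 + scal (?r * qnum ?q m) * xv I1 ^ Suc m)"
  let ?e = "xv I2 * xv I1 - (scal ?q * xv I1 * xv I2 + scal ?r * xv I1 ^ 2)"
  have e: "?e \<in> rel_ideal (B_rels F)"
    using rel_ideal_incl[of "B_rels F"] by (auto simp: B_rels_def)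
  have c: "xv I1 ^ m * scal a = scal a * xv I1 ^ m" "xv I1 ^ m * (scal a * z) = scal a * (xv I1 ^ m * z)"
    for a :: 'k and z
    by (simp_all add: scal_pow_commute flip: mult.assoc)
  have h: "z * xv I1 ^ m * xv I1 = z * xv I1 * xv I1 ^ m" for z :: "(var, 'k) free_alg"
    by (simp add: mult.assoc power_commutes)
  have "xv I2 * xv I1 ^ Suc m - (scal (?q ^ Suc m) * xv I1 ^ Suc m * xv I2
           + scal (?r * qnum ?q (Suc m)) * xv I1 ^ Suc (Suc m))
        = ?d * xv I1 + scal (?q ^ m) * xv I1 ^ m * ?e"
    by (simp add: algebra_simps scal_add scal_mult qnum_Suc power2_eq_square c power_commutes
          flip: scal_mult) (simp add: mult.commute h flip: mult.assoc scal_mult)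
  then show ?case
    using Suc e by (simp add: rel_ideal_add rel_ideal_lmult rel_ideal_rmult)
qed

lemma rel_ideal_sum: "(\<And>k. k \<in> A \<Longrightarrow> f k \<in> rel_ideal S) \<Longrightarrow> sum f A \<in> rel_ideal S"
  by (induction A rule: infinite_finite_induct) (auto simp: rel_ideal_zero rel_ideal_add)

lemma x2_pow_x1:
  fixes F :: "'k::field family"
  shows "xv I2 ^ n * xv I1
           - (\<Sum>k\<le>n. scal (Lambda (q_par F) (r_par F) n 1 k) * xv I1 ^ Suc k * xv I2 ^ (n - k))
         \<in> rel_ideal (B_rels F)"
proof (induction n)
  case 0
  then show ?case by (simp add: Lambda_def qrising_def scal_one rel_ideal_zero)
next
  case (Suc n)
  let ?q = "q_par F" and ?r = "r_par F"
  let ?L = "Lambda ?q ?r"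
  let ?S = "\<lambda>n. \<Sum>k\<le>n. scal (?L n 1 k) * xv I1 ^ Suc k * xv I2 ^ (n - k)"
  let ?t = "\<lambda>m. scal (?q ^ m) * xv I1 ^ m * xv I2 + scal (?r * qnum ?q m) * xv I1 ^ Suc m"
  have c: "xv I2 * (scal a * z) = scal a * (xv I2 * z)" for a :: 'k and z
    by (simp add: scal_gen_commute flip: mult.assoc)
  have "?S (Suc n) =
      (\<Sum>k\<le>Suc n. scal (?L n 1 k * ?q ^ Suc k) * xv I1 ^ Suc k * xv I2 ^ (Suc n - k))
    + (\<Sum>k\<le>Suc n. scal (case k of 0 \<Rightarrow> 0 | Suc k' \<Rightarrow> ?L n 1 k' * ?r * qnum ?q k)
         * xv I1 ^ Suc k * xv I2 ^ (Suc n - k))"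
    by (simp only: Lambda_Suc scal_add distrib_right sum.distrib)
  also have "(\<Sum>k\<le>Suc n. scal (?L n 1 k * ?q ^ Suc k) * xv I1 ^ Suc k * xv I2 ^ (Suc n - k))
    = (\<Sum>k\<le>n. scal (?L n 1 k) * (scal (?q ^ Suc k) * xv I1 ^ Suc k * xv I2) * xv I2 ^ (n - k))"
    by (simp add: Lambda_def scal_zero Suc_diff_le scal_mult mult.assoc del: power_Suc)
       (auto intro!: sum.cong simp: Suc_diff_le mult.assoc)
  also have "(\<Sum>k\<le>Suc n. scal (case k of 0 \<Rightarrow> 0 | Suc k' \<Rightarrow> ?L n 1 k' * ?r * qnum ?q k)
         * xv I1 ^ Suc k * xv I2 ^ (Suc n - k))
    = (\<Sum>k\<le>n. scal (?L n 1 k) * (scal (?r * qnum ?q (Suc k)) * xv I1 ^ Suc (Suc k)) * xv I2 ^ (n - k))"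
    by (subst sum.atMost_Suc_shift) (simp add: scal_zero scal_mult mult.assoc)
  finally have S: "?S (Suc n) = (\<Sum>k\<le>n. scal (?L n 1 k) * ?t (Suc k) * xv I2 ^ (n - k))"
    by (simp only: distrib_left distrib_right sum.distrib)
  have "xv I2 ^ Suc n * xv I1 - ?S (Suc n)
      = xv I2 * (xv I2 ^ n * xv I1 - ?S n)
        + (\<Sum>k\<le>n. scal (?L n 1 k) * (xv I2 * xv I1 ^ Suc k - ?t (Suc k)) * xv I2 ^ (n - k))"
    unfolding S
    by (simp add: right_diff_distrib left_diff_distrib sum_subtractf sum_distrib_left mult.assoc c
             del: power_Suc) (simp add: mult.assoc)
  then show ?case
    using Suc by (simp only: rel_ideal_add rel_ideal_lmult rel_ideal_rmult rel_ideal_sum x2_x1_pow)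
qed

lemma Omega_expansion:
  fixes F :: "'k::field family"
  shows "cls (B_rels F) (xv I1 ^ \<mu> * xv I2 ^ \<nu> * xv t) =
    cls (B_rels F) (Sum_any (\<lambda>(\<alpha>, \<beta>). scal (Omega F \<mu> \<nu> t \<alpha> \<beta>) * xv I1 ^ \<alpha> * xv I2 ^ \<beta>))"
proof (cases t)
  case I2
  have "Sum_any (\<lambda>(\<alpha>, \<beta>). scal (Omega F \<mu> \<nu> I2 \<alpha> \<beta>) * xv I1 ^ \<alpha> * xv I2 ^ \<beta>)
      = (\<Sum>(\<alpha>, \<beta>)\<in>{(\<mu>, Suc \<nu>)}. scal (Omega F \<mu> \<nu> I2 \<alpha> \<beta>) * xv I1 ^ \<alpha> * xv I2 ^ \<beta>)"
    by (rule Sum_any.expand_superset) (auto simp: Omega_def scal_zero of_bool_def split: if_splits)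
  also have "\<dots> = xv I1 ^ \<mu> * xv I2 ^ \<nu> * xv I2"
    by (simp add: Omega_def scal_one mult.assoc power_commutes)
  finally show ?thesis using I2 by simp
next
  case I1
  let ?L = "Lambda (q_par F) (r_par F) \<nu> 1"
  let ?g = "\<lambda>k. (\<mu> + 1 + k, \<nu> - k)"
  have Om: "Omega F \<mu> \<nu> I1 (\<mu> + 1 + k) (\<nu> - k) = ?L k" if "k \<le> \<nu>" for k
  proof -
    have "Omega F \<mu> \<nu> I1 (\<mu> + 1 + k) (\<nu> - k) = (\<Sum>k'\<le>\<nu>. if k' = k then ?L k' else 0)"
      unfolding Omega_def by (auto intro!: sum.cong)
    then show ?thesis using that by simp
  qed
  have Z: "Omega F \<mu> \<nu> I1 \<alpha> \<beta> = 0" if "(\<alpha>, \<beta>) \<notin> ?g ` {..\<nu>}" for \<alpha> \<beta>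
    unfolding Omega_def using that by (auto intro!: sum.neutral)
  have "Sum_any (\<lambda>(\<alpha>, \<beta>). scal (Omega F \<mu> \<nu> I1 \<alpha> \<beta>) * xv I1 ^ \<alpha> * xv I2 ^ \<beta>)
      = (\<Sum>(\<alpha>, \<beta>)\<in>?g ` {..\<nu>}. scal (Omega F \<mu> \<nu> I1 \<alpha> \<beta>) * xv I1 ^ \<alpha> * xv I2 ^ \<beta>)"
  proof (rule Sum_any.expand_superset)
    show "{a. (case a of (\<alpha>, \<beta>) \<Rightarrow> scal (Omega F \<mu> \<nu> I1 \<alpha> \<beta>) * xv I1 ^ \<alpha> * xv I2 ^ \<beta>) \<noteq> 0}
        \<subseteq> ?g ` {..\<nu>}"
    proof (clarify, rule ccontr)
      fix \<alpha> \<beta>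
      assume "scal (Omega F \<mu> \<nu> I1 \<alpha> \<beta>) * xv I1 ^ \<alpha> * xv I2 ^ \<beta> \<noteq> 0" "(\<alpha>, \<beta>) \<notin> ?g ` {..\<nu>}"
      then show False using Z[of \<alpha> \<beta>] by (simp add: scal_zero)
    qed
  qed simp
  also have "\<dots> = (\<Sum>k\<le>\<nu>. scal (Omega F \<mu> \<nu> I1 (\<mu> + 1 + k) (\<nu> - k)) * xv I1 ^ (\<mu> + 1 + k) * xv I2 ^ (\<nu> - k))"
    by (subst sum.reindex) (auto simp: inj_on_def)
  also have "\<dots> = (\<Sum>k\<le>\<nu>. xv I1 ^ \<mu> * (scal (?L k) * xv I1 ^ Suc k * xv I2 ^ (\<nu> - k)))"
  proof (intro sum.cong refl)
    fix k assume "k \<in> {..\<nu>}"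
    then have "scal (Omega F \<mu> \<nu> I1 (\<mu> + 1 + k) (\<nu> - k)) = scal (?L k)"
      using Om by simp
    then show "scal (Omega F \<mu> \<nu> I1 (\<mu> + 1 + k) (\<nu> - k)) * xv I1 ^ (\<mu> + 1 + k) * xv I2 ^ (\<nu> - k)
        = xv I1 ^ \<mu> * (scal (?L k) * xv I1 ^ Suc k * xv I2 ^ (\<nu> - k))"
      by (metis (no_types, lifting) add.assoc mult.assoc plus_1_eq_Suc power_add scal_pow_commute)
  qed
  also have "\<dots> = xv I1 ^ \<mu> * (\<Sum>k\<le>\<nu>. scal (?L k) * xv I1 ^ Suc k * xv I2 ^ (\<nu> - k))"
    by (simp only: sum_distrib_left)
  finally have eq: "Sum_any (\<lambda>(\<alpha>, \<beta>). scal (Omega F \<mu> \<nu> I1 \<alpha> \<beta>) * xv I1 ^ \<alpha> * xv I2 ^ \<beta>)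
      = xv I1 ^ \<mu> * (\<Sum>k\<le>\<nu>. scal (?L k) * xv I1 ^ Suc k * xv I2 ^ (\<nu> - k))" .
  have "xv I1 ^ \<mu> * xv I2 ^ \<nu> * xv I1 - xv I1 ^ \<mu> * (\<Sum>k\<le>\<nu>. scal (?L k) * xv I1 ^ Suc k * xv I2 ^ (\<nu> - k))
      \<in> rel_ideal (B_rels F)"
    using rel_ideal_lmult[OF x2_pow_x1[of \<nu> F], of "xv I1 ^ \<mu>"]
    by (simp only: right_diff_distrib mult.assoc)
  then show ?thesis unfolding I1 eq by (rule cls_eqI)
qed


section \<open>The expansion of \<open>y\<^sub>i x\<^sub>1\<^sup>a x\<^sub>2\<^sup>b\<close>\<close>

definition is_expansion ::
    "'k::field family \<Rightarrow> idx \<Rightarrow> nat \<Rightarrow> nat \<Rightarrow> (nat \<Rightarrow> nat \<Rightarrow> idx \<Rightarrow> 'k) \<Rightarrow> bool" where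
  "is_expansion F i a b w \<longleftrightarrow>
     finite {(\<alpha>, \<beta>, l). w \<alpha> \<beta> l \<noteq> 0} \<and>
     NF F (yv i * xv I1 ^ a * xv I2 ^ b) =
       Sum_any (\<lambda>(\<alpha>, \<beta>, l). scal (w \<alpha> \<beta> l) * xv I1 ^ \<alpha> * xv I2 ^ \<beta> * yv l)"

end

theory Submission
  imports Defs
begin

text \<open>
  The \<open>x\<close>-monomials are independent modulo the relation of \<open>R\<close>, because \<open>R\<close> acts on coefficient arrays
  by its own left multiplication and the monomials send the unit array to distinct unit arrays.
  Freeness of \<open>B\<close> as a left \<open>R\<close>-module then makes normal forms unique.  For existence, multiplying an
  expansion \<open>\<Sum> w x\<^sub>1\<^sup>\<mu> x\<^sub>2\<^sup>\<nu> y\<^sub>j\<close> on the right by \<open>x\<^sub>\<epsilon>\<close>, moving \<open>x\<^sub>\<epsilon>\<close> past \<open>y\<^sub>j\<close> by the mixed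
  relations and then straightening \<open>x\<^sub>1\<^sup>\<mu> x\<^sub>2\<^sup>\<nu> x\<^sub>t\<close> by \<open>\<Omega>\<close> yields exactly the recursion.
\<close>

section \<open>Presented algebras\<close>

lemma cls_eq_iff: "cls S u = cls S v \<longleftrightarrow> u - v \<in> rel_ideal S"
proof
  have cls: "cls S w = {i + w | i. i \<in> rel_ideal S}" for w
    by (auto simp: cls_def a_r_coset_def' ring_of_type_algebra_def)
  assume "cls S u = cls S v"
  moreover have "u \<in> cls S u"
    using rel_ideal_zero[of S] by (force simp: cls)
  ultimately obtain i where "i \<in> rel_ideal S" "u = i + v"
    by (auto simp: cls)
  then show "u - v \<in> rel_ideal S" by simp
qed (rule cls_eqI)

lemma rel_ideal_uminus: "u \<in> rel_ideal S \<Longrightarrow> - u \<in> rel_ideal S"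
  using rel_ideal_lmult[of u S "-1"] by simp

lemma rel_ideal_minus_trans:
  "u - v \<in> rel_ideal S \<Longrightarrow> v - w \<in> rel_ideal S \<Longrightarrow> u - w \<in> rel_ideal S"
  using rel_ideal_add[of "u - v" S "v - w"] by simp

text \<open>Left multiplication by \<open>-1\<close> supplies negatives, so these closure properties
  make \<open>I\<close> an ideal. Its use is to show that an action that kills the relations kills
  everything they generate.\<close>

lemma rel_ideal_minimal:
  assumes "S \<subseteq> I" "0 \<in> I"
    and "\<And>u v. u \<in> I \<Longrightarrow> v \<in> I \<Longrightarrow> u + v \<in> I"
    and l: "\<And>u v. u \<in> I \<Longrightarrow> v * u \<in> I" and "\<And>u v. u \<in> I \<Longrightarrow> u * v \<in> I"
  shows "rel_ideal S \<subseteq> I"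
proof -
  interpret A: ring "ring_of_type_algebra :: ('a, 'b) free_alg ring" by (rule ring_free_alg)
  have inv: "\<ominus>\<^bsub>ring_of_type_algebra\<^esub> u = - u" for u :: "('a, 'b) free_alg"
    by (rule A.minus_equality) (simp_all add: ring_of_type_algebra_def)
  have "- u \<in> I" if "u \<in> I" for u
    using l[OF that, of "-1"] by simp
  then have "subgroup I (add_monoid (ring_of_type_algebra :: ('a, 'b) free_alg ring))"
    using assms(2,3) inv
    by unfold_locales (auto simp: ring_of_type_algebra_def a_inv_def)
  then have "ideal I (ring_of_type_algebra :: ('a, 'b) free_alg ring)"
    using assms(4,5) by (intro idealI ring_free_alg) (auto simp: ring_of_type_algebra_def)
  then show ?thesis
    unfolding rel_ideal_def using assms(1) by (intro A.genideal_minimal)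
qed

lemma ring_presented: "ring (presented S)"
  unfolding presented_def by (rule ideal.quotient_is_ring[OF ideal_rel_ideal])

lemma cls_ring_hom: "cls S \<in> ring_hom ring_of_type_algebra (presented S)"
  using ideal.rcos_ring_hom[OF ideal_rel_ideal[of S]]
  by (simp add: presented_def cls_def[abs_def])

lemma cls_in_carrier [simp]: "cls S u \<in> carrier (presented S)"
  using ring_hom_closed[OF cls_ring_hom, of u S] by (simp add: ring_of_type_algebra_def)

lemma cls_add: "cls S (u + v) = cls S u \<oplus>\<^bsub>presented S\<^esub> cls S v"
  using ring_hom_add[OF cls_ring_hom, of u v S] by (simp add: ring_of_type_algebra_def)

lemma cls_mult: "cls S (u * v) = cls S u \<otimes>\<^bsub>presented S\<^esub> cls S v"
  using ring_hom_mult[OF cls_ring_hom, of u v S] by (simp add: ring_of_type_algebra_def)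

lemma cls_one: "cls S 1 = \<one>\<^bsub>presented S\<^esub>"
  using ring_hom_one[OF cls_ring_hom, of S] by (simp add: ring_of_type_algebra_def)

lemma cls_zero: "cls S 0 = \<zero>\<^bsub>presented S\<^esub>"
proof -
  interpret P: ring "presented S" by (rule ring_presented)
  have "cls S 0 = cls S 0 \<oplus>\<^bsub>presented S\<^esub> cls S 0"
    using cls_add[of S 0 0] by simp
  then show ?thesis
    by (simp add: P.add.l_cancel_one')
qed

lemma cls_power: "cls S (u ^ n) = cls S u [^]\<^bsub>presented S\<^esub> n"
proof (induction n)
  case 0
  then show ?case by (simp add: cls_one Group.nat_pow_def)
next
  case (Suc n)
  interpret P: ring "presented S" by (rule ring_presented)
  from Suc show ?case by (simp add: cls_mult power_Suc2 del: power_Suc)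
qed

lemma cls_sum:
  assumes "finite A"
  shows "cls S (sum f A) = (\<Oplus>\<^bsub>presented S\<^esub>n\<in>A. cls S (f n))"
proof -
  interpret P: ring "presented S" by (rule ring_presented)
  from assms show ?thesis
    by induction (simp_all add: cls_zero cls_add)
qed

section \<open>Linear actions of free algebras\<close>

text \<open>\<open>update_induct\<close> only sets a key outside the support, so each update adds a
  single term. Identities additive in \<open>u\<close> thereby reduce to scalar multiples of one
  word.\<close>

lemma poly_mapping_additive_induct [case_names single add]:
  assumes single: "\<And>k c. P (Poly_Mapping.single k c)"
    and add: "\<And>u v. P u \<Longrightarrow> P v \<Longrightarrow> P (u + v)"
  shows "P (u :: 'a \<Rightarrow>\<^sub>0 'b::comm_monoid_add)"
proof (induction u rule: update_induct)
  case const
  show ?case using single[of undefined 0] by simp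
next
  case (update f a b)
  then have "Poly_Mapping.update a b f = f + Poly_Mapping.single a b"
    by (intro poly_mapping_eqI)
      (auto simp: lookup_update lookup_add lookup_single when_def in_keys_iff)
  with update show ?case by (simp add: single add)
qed

text \<open>The universal property of the free algebra in module form: linear operators, one for
  each generator, extend to an action. The vectors are arbitrary functions, without finite support,
  so no carrier has to be tracked.\<close>

locale free_alg_action =
  fixes T :: "'g \<Rightarrow> ('i \<Rightarrow> 'k::field) \<Rightarrow> 'i \<Rightarrow> 'k"
  assumes T_add: "T g (\<lambda>x. v x + w x) = (\<lambda>x. T g v x + T g w x)"
    and T_scale: "T g (\<lambda>x. c * v x) = (\<lambda>x. c * T g v x)"
begin

text \<open>With \<open>foldr\<close> the last letter acts first, so concatenation becomes
  composition and the result is a left action.\<close>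

fun word_act :: "'g word \<Rightarrow> ('i \<Rightarrow> 'k) \<Rightarrow> 'i \<Rightarrow> 'k" where
  "word_act (Word gs) v = foldr T gs v"

lemma word_act_add: "word_act u (\<lambda>x. v x + w x) = (\<lambda>x. word_act u v x + word_act u w x)"
proof (cases u)
  case (Word gs)
  have "foldr T gs (\<lambda>x. v x + w x) = (\<lambda>x. foldr T gs v x + foldr T gs w x)"
    by (induction gs) (simp_all add: T_add)
  with Word show ?thesis by simp
qed

lemma word_act_scale: "word_act u (\<lambda>x. c * v x) = (\<lambda>x. c * word_act u v x)"
proof (cases u)
  case (Word gs)
  have "foldr T gs (\<lambda>x. c * v x) = (\<lambda>x. c * foldr T gs v x)"
    by (induction gs) (simp_all add: T_scale)
  with Word show ?thesis by simp
qed

lemma word_act_plus: "word_act (u + w) v = word_act u (word_act w v)"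
  by (cases u; cases w) simp

lemma word_act_0: "word_act 0 v = v"
  by (simp add: zero_word_def)

definition act :: "('g, 'k) free_alg \<Rightarrow> ('i \<Rightarrow> 'k) \<Rightarrow> 'i \<Rightarrow> 'k" where
  "act u v x = (\<Sum>w\<in>Poly_Mapping.keys u. Poly_Mapping.lookup u w * word_act w v x)"

lemma act_superset:
  assumes "finite K" "Poly_Mapping.keys u \<subseteq> K"
  shows "act u v x = (\<Sum>w\<in>K. Poly_Mapping.lookup u w * word_act w v x)"
  unfolding act_def using assms
  by (intro sum.mono_neutral_left) (auto simp: in_keys_iff)

lemma act_plus: "act (u + u') v = (\<lambda>x. act u v x + act u' v x)"
proof
  fix x
  let ?K = "Poly_Mapping.keys u \<union> Poly_Mapping.keys u'"
  have "act (u + u') v x = (\<Sum>w\<in>?K. Poly_Mapping.lookup (u + u') w * word_act w v x)"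
    by (rule act_superset) (auto simp: Poly_Mapping.keys_add)
  also have "\<dots> = act u v x + act u' v x"
    by (simp add: act_superset[of ?K] lookup_add distrib_right sum.distrib)
  finally show "act (u + u') v x = act u v x + act u' v x" .
qed

lemma act_single: "act (Poly_Mapping.single w c) v x = c * word_act w v x"
  by (simp add: act_def)

lemma act_add: "act u (\<lambda>x. v x + w x) = (\<lambda>x. act u v x + act u w x)"
  by (simp add: act_def word_act_add distrib_left sum.distrib fun_eq_iff)

lemma act_zero_right: "act u (\<lambda>x. 0) = (\<lambda>x. 0)"
  using word_act_scale[of _ 0 "\<lambda>x. 0"] by (simp add: act_def fun_eq_iff)

lemma act_zero: "act 0 v = (\<lambda>x. 0)"
  by (simp add: act_def fun_eq_iff)

text \<open>Both sides are additive in each factor, which leaves two single words, where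
  concatenation is composition of operators.\<close>

lemma act_mult: "act (u * u') v = act u (act u' v)"
proof (induction u rule: poly_mapping_additive_induct)
  case (single w c)
  show ?case
  proof (induction u' rule: poly_mapping_additive_induct)
    case (single w' c')
    have "act (Poly_Mapping.single w' c') v = (\<lambda>x. c' * word_act w' v x)"
      by (simp add: act_single fun_eq_iff)
    then show ?case
      by (simp add: mult_single act_single word_act_plus word_act_scale fun_eq_iff)
  next
    case (add u u')
    then show ?case by (simp add: distrib_left act_plus act_add)
  qed
next
  case (add u u')
  then show ?case by (simp add: distrib_right act_plus fun_eq_iff)
qed

lemma act_gen: "act (gen g) v = T g v"
  by (simp add: gen_def act_single fun_eq_iff)

lemma act_scal: "act (scal c) v = (\<lambda>x. c * v x)"
  by (simp add: scal_def act_single word_act_0 fun_eq_iff)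

lemma act_gen_power: "act (gen g ^ n) v = (T g ^^ n) v"
proof (induction n)
  case 0
  show ?case using act_scal[of 1 v] by (simp add: scal_one)
qed (simp add: act_mult act_gen)

lemma act_diff: "act (u - u') v x = act u v x - act u' v x"
  using fun_cong[OF act_plus[of "u - u'" u' v], of x] by simp

lemma act_sum: "act (sum f A) v x = (\<Sum>i\<in>A. act (f i) v x)"
  by (induction A rule: infinite_finite_induct) (simp_all add: act_zero act_plus)

text \<open>The elements that kill every vector form a two-sided ideal. Quantifying over all vectors
  gives closure under right multiplication, since \<open>u * t\<close> acts on \<open>v\<close> as
  \<open>u\<close> acts on the image of \<open>v\<close> under \<open>t\<close>.\<close>

lemma act_rel_ideal:
  assumes "u \<in> rel_ideal S" "\<And>s v. s \<in> S \<Longrightarrow> act s v = (\<lambda>x. 0)"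
  shows "act u v = (\<lambda>x. 0)"
proof -
  have "rel_ideal S \<subseteq> {u. \<forall>v. act u v = (\<lambda>x. 0)}"
    by (rule rel_ideal_minimal)
      (use assms(2) in \<open>auto simp: act_zero act_plus act_mult act_zero_right\<close>)
  with assms(1) show ?thesis by blast
qed

end


section \<open>Independence of the ordered monomials in the generators of \<open>R\<close>\<close>

text \<open>
  The left multiplications by \<open>x\<^sub>1\<close> and \<open>x\<^sub>2\<close> on coefficient arrays: in \<open>R\<close> one has
  \<open>x\<^sub>2 x\<^sub>1\<^sup>a x\<^sub>2\<^sup>b = q\<^sup>a x\<^sub>1\<^sup>a x\<^sub>2\<^sup>b\<^sup>+\<^sup>1 + r [a]\<^sub>q x\<^sub>1\<^sup>a\<^sup>+\<^sup>1 x\<^sub>2\<^sup>b\<close>.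
\<close>

definition x_shift :: "'k::field \<Rightarrow> 'k \<Rightarrow> idx \<Rightarrow> (nat \<times> nat \<Rightarrow> 'k) \<Rightarrow> nat \<times> nat \<Rightarrow> 'k" where
  "x_shift q r t v = (\<lambda>(a, b). case t of
     I1 \<Rightarrow> (case a of 0 \<Rightarrow> 0 | Suc a' \<Rightarrow> v (a', b))
   | I2 \<Rightarrow> (case b of 0 \<Rightarrow> 0 | Suc b' \<Rightarrow> q ^ a * v (a, b')) +
          (case a of 0 \<Rightarrow> 0 | Suc a' \<Rightarrow> r * qnum q a' * v (a', b)))"

interpretation x_shift: free_alg_action "x_shift q r"
  for q r :: "'k::field"
  by unfold_locales
    (auto simp: x_shift_def fun_eq_iff algebra_simps split: idx.split nat.split)

lemma qnum_Suc_shift: "qnum q (Suc n) = 1 + q * qnum q n"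
  by (simp add: qnum_def sum.lessThan_Suc_shift sum_distrib_left del: sum.lessThan_Suc)

text \<open>The terms with a power of \<open>q\<close> agree at once. The terms with factor
  \<open>r\<close> agree by \<open>qnum_Suc_shift\<close>, and at the boundary because
  \<open>qnum q 0\<close> is 0.\<close>

lemma x_shift_rel:
  "x_shift q r I2 (x_shift q r I1 v) =
     (\<lambda>n. q * x_shift q r I1 (x_shift q r I2 v) n + r * x_shift q r I1 (x_shift q r I1 v) n)"
proof (rule ext, clarify)
  fix a b :: nat
  show "x_shift q r I2 (x_shift q r I1 v) (a, b) =
     q * x_shift q r I1 (x_shift q r I2 v) (a, b) + r * x_shift q r I1 (x_shift q r I1 v) (a, b)"
    by (auto simp: x_shift_def qnum_Suc_shift qnum_def[of _ 0] algebra_simps split: nat.split)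
qed

text \<open>The array at (0, 0) plays the role of the unit of \<open>R\<close>. The operator of
  \<open>I2\<close> acts first, while the first exponent is still 0; there \<open>q ^ 0 = 1\<close>
  and \<open>qnum q 0 = 0\<close> turn it into a pure shift.\<close>

lemma x_shift_monomial:
  "(x_shift q r I1 ^^ a) ((x_shift q r I2 ^^ b) (\<lambda>n. of_bool (n = (0, 0)))) =
     (\<lambda>n. of_bool (n = (a, b)))"
proof -
  have x1: "x_shift q r I1 (\<lambda>n. of_bool (n = (a, b))) = (\<lambda>n. of_bool (n = (Suc a, b)))" for a b
    by (auto simp: x_shift_def split: nat.split)
  have x2: "x_shift q r I2 (\<lambda>n. of_bool (n = (0, b))) = (\<lambda>n. of_bool (n = (0, Suc b)))" for b
  proof (rule ext, clarify)
    fix a c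
    show "x_shift q r I2 (\<lambda>n. of_bool (n = (0, b))) (a, c) = of_bool ((a, c) = (0, Suc b))"
      by (cases a; cases c) (simp_all add: x_shift_def qnum_def of_bool_def)
  qed
  have "(x_shift q r I2 ^^ b) (\<lambda>n. of_bool (n = (0, 0))) = (\<lambda>n. of_bool (n = (0, b)))"
    by (induction b) (simp_all only: funpow.simps comp_def id_def x2)
  then show ?thesis
    by (induction a) (simp_all only: funpow.simps comp_def id_def x1)
qed

text \<open>An element of the ideal kills the array at (0, 0), whereas the sum sends it to an array
  whose entry at a pair in \<open>A\<close> is the coefficient \<open>h\<close> of that
  pair.\<close>

lemma R_monomials_independent:
  fixes F :: "'k::field family"
  assumes "(\<Sum>(a, b)\<in>A. scal (h a b) * gen I1 ^ a * gen I2 ^ b) \<in> rel_ideal (R_rels F)"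
    and "finite A" "(a, b) \<in> A"
  shows "h a b = 0"
proof -
  let ?T = "x_shift (q_par F) (r_par F)"
  let ?act = "x_shift.act (q_par F) (r_par F)"
  let ?v = "\<lambda>n. of_bool (n = (0, 0)) :: 'k"
  have "?act (\<Sum>(a, b)\<in>A. scal (h a b) * gen I1 ^ a * gen I2 ^ b) ?v = (\<lambda>x. 0)"
    using assms(1)
  proof (rule x_shift.act_rel_ideal)
    fix s v assume "s \<in> R_rels F"
    then show "?act s v = (\<lambda>x. 0)"
      by (auto simp: R_rels_def x_shift.act_diff x_shift.act_plus x_shift.act_mult
          x_shift.act_gen x_shift.act_scal x_shift_rel power2_eq_square)
  qed
  moreover have "?act (\<Sum>(a, b)\<in>A. scal (h a b) * gen I1 ^ a * gen I2 ^ b) ?v (a, b)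
      = (\<Sum>n\<in>A. if n = (a, b) then h a b else 0)"
    by (auto simp: x_shift.act_sum x_shift.act_mult x_shift.act_scal x_shift.act_gen_power
        x_shift_monomial intro!: sum.cong)
  ultimately show ?thesis
    using assms(2,3) by simp
qed

lemma scal_diff: "scal (c - d) = scal c - scal d"
  by (rule eq_diff_eq[THEN iffD2]) (simp flip: scal_add)

section \<open>Uniqueness of normal forms\<close>

text \<open>Grouping by the y-part turns the inner sums into elements of the image of
  \<open>R\<close>, so the class is written in the left basis of \<open>B\<close>. Uniqueness of
  coordinates, injectivity of \<open>\<phi>\<close> and independence of the x-monomials in
  \<open>R\<close> are then applied in turn.\<close>

lemma normal_sum_unique:
  fixes F :: "'k::field family" and h h' :: "nat \<Rightarrow> nat \<Rightarrow> nat \<Rightarrow> nat \<Rightarrow> 'k"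
  defines "S g A C \<equiv> (\<Sum>(c, d)\<in>C. (\<Sum>(a, b)\<in>A. scal (g a b c d) * xv I1 ^ a * xv I2 ^ b)
                        * (yv I1 ^ c * yv I2 ^ d))"
  assumes adm: "admissible F" and fin: "finite A" "finite C"
    and eq: "cls (B_rels F) (S h A C) = cls (B_rels F) (S h' A C)"
    and mem: "(a, b) \<in> A" "(c, d) \<in> C"
  shows "h a b c d = h' a b c d"
proof -
  let ?B = "presented (B_rels F)" and ?R = "presented (R_rels F)"
  let ?cB = "cls (B_rels F)" and ?cR = "cls (R_rels F)"
  interpret B: ring ?B by (rule ring_presented)
  interpret R: ring ?R by (rule ring_presented)
  from adm obtain \<phi> where \<phi>: "\<phi> \<in> ring_hom ?R ?B"
    and \<phi>_scal: "\<And>c. \<phi> (?cR (scal c)) = ?cB (scal c)"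
    and \<phi>_gen: "\<And>s. \<phi> (?cR (gen s)) = ?cB (xv s)"
    and inj: "inj_on \<phi> (carrier ?R)"
    and tde: "trimmed_double_extension ?B (\<lambda>c. ?cB (scal c)) (\<phi> ` carrier ?R) (?cB (yv I1)) (?cB (yv I2))"
    unfolding admissible_def by blast
  let ?e = "\<lambda>(i, j). ?cB (yv I1) [^]\<^bsub>?B\<^esub> (i::nat) \<otimes>\<^bsub>?B\<^esub> ?cB (yv I2) [^]\<^bsub>?B\<^esub> (j::nat)"
  have basis: "free_left_basis ?B (\<phi> ` carrier ?R) ?e"
    using tde unfolding trimmed_double_extension_def by blast
  have \<phi>_add: "\<phi> (?cR (u + v)) = \<phi> (?cR u) \<oplus>\<^bsub>?B\<^esub> \<phi> (?cR v)" for u v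
    by (simp add: cls_add ring_hom_add[OF \<phi>])
  have \<phi>_mult: "\<phi> (?cR (u * v)) = \<phi> (?cR u) \<otimes>\<^bsub>?B\<^esub> \<phi> (?cR v)" for u v
    by (simp add: cls_mult ring_hom_mult[OF \<phi>])
  have \<phi>_zero: "\<phi> (?cR 0) = \<zero>\<^bsub>?B\<^esub>"
    using \<phi>_scal[of 0] by (simp add: scal_zero cls_zero)
  have \<phi>_pow: "\<phi> (?cR (gen s ^ n)) = ?cB (xv s ^ n)" for s n
  proof (induction n)
    case 0
    show ?case using \<phi>_scal[of 1] by (simp add: scal_one)
  qed (simp add: \<phi>_mult \<phi>_gen flip: cls_mult)
  have \<phi>_poly: "\<phi> (?cR (\<Sum>(a, b)\<in>A. scal (g a b) * gen I1 ^ a * gen I2 ^ b)) =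
      ?cB (\<Sum>(a, b)\<in>A. scal (g a b) * xv I1 ^ a * xv I2 ^ b)" for g
    using fin(1)
  proof induction
    case empty
    then show ?case by (simp add: \<phi>_zero flip: cls_zero)
  next
    case (insert n A)
    then show ?case
      by (cases n) (simp add: \<phi>_add \<phi>_mult \<phi>_scal \<phi>_pow flip: cls_add cls_mult)
  qed
  \<comment> \<open>Coordinates must be total functions on pairs of exponents, hence the value 0 off
    \<open>C\<close>. \<open>\<rho>\<close> takes values in the free algebra over the generators of
    \<open>R\<close>, and \<open>\<gamma>\<close> is its image in \<open>B\<close>.\<close>
  define \<rho> where "\<rho> g = (\<lambda>(c, d). if (c, d) \<in> C
      then (\<Sum>(a, b)\<in>A. scal (g a b c d) * gen I1 ^ a * gen I2 ^ b) else 0)"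
    for g :: "nat \<Rightarrow> nat \<Rightarrow> nat \<Rightarrow> nat \<Rightarrow> 'k"
  define \<gamma> where "\<gamma> g n = \<phi> (?cR (\<rho> g n))" for g n
  have \<gamma>_carrier: "\<gamma> g n \<in> carrier ?B" for g n
    unfolding \<gamma>_def by (rule ring_hom_closed[OF \<phi>]) simp
  have e_carrier: "?e n \<in> carrier ?B" for n
    by (cases n) simp
  have \<gamma>_supp: "{n. \<gamma> g n \<noteq> \<zero>\<^bsub>?B\<^esub>} \<subseteq> C" for g
    by (auto simp: \<gamma>_def \<rho>_def \<phi>_zero split: if_splits)
  define is_coord where "is_coord u c \<longleftrightarrow> range c \<subseteq> \<phi> ` carrier ?R \<and> finite {n. c n \<noteq> \<zero>\<^bsub>?B\<^esub>} \<and>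
      u = (\<Oplus>\<^bsub>?B\<^esub>n\<in>{n. c n \<noteq> \<zero>\<^bsub>?B\<^esub>}. c n \<otimes>\<^bsub>?B\<^esub> ?e n)" for u c
  have \<gamma>_coord: "is_coord (?cB (S g A C)) (\<gamma> g)" for g
    unfolding is_coord_def
  proof (intro conjI)
    show "range (\<gamma> g) \<subseteq> \<phi> ` carrier ?R" by (auto simp: \<gamma>_def)
    show "finite {n. \<gamma> g n \<noteq> \<zero>\<^bsub>?B\<^esub>}" using \<gamma>_supp fin(2) by (rule finite_subset)
    have "?cB (S g A C) = (\<Oplus>\<^bsub>?B\<^esub>n\<in>C. \<gamma> g n \<otimes>\<^bsub>?B\<^esub> ?e n)"
      unfolding S_def cls_sum[OF fin(2)]
    proof (rule B.finsum_cong')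
      fix n assume "n \<in> C"
      then show "?cB (case n of (c, d) \<Rightarrow> (\<Sum>(a, b)\<in>A. scal (g a b c d) * xv I1 ^ a * xv I2 ^ b)
                        * (yv I1 ^ c * yv I2 ^ d)) = \<gamma> g n \<otimes>\<^bsub>?B\<^esub> ?e n"
        by (cases n) (simp add: cls_mult cls_power \<gamma>_def \<rho>_def \<phi>_poly)
    qed (use \<gamma>_carrier e_carrier in auto)
    \<comment> \<open>\<open>free_left_basis\<close> sums over the exact support, while
      \<open>C\<close> may contain indices whose coordinate is zero.\<close>
    also have "\<dots> = (\<Oplus>\<^bsub>?B\<^esub>n\<in>{n. \<gamma> g n \<noteq> \<zero>\<^bsub>?B\<^esub>}. \<gamma> g n \<otimes>\<^bsub>?B\<^esub> ?e n)"
      using \<gamma>_supp[of g] fin(2) \<gamma>_carrier e_carrier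
      by (intro B.add.finprod_mono_neutral_cong_right) auto
    finally show "?cB (S g A C) = (\<Oplus>\<^bsub>?B\<^esub>n\<in>{n. \<gamma> g n \<noteq> \<zero>\<^bsub>?B\<^esub>}. \<gamma> g n \<otimes>\<^bsub>?B\<^esub> ?e n)" .
  qed
  have "\<exists>!c. is_coord (?cB (S h A C)) c"
    using conjunct2[OF basis[unfolded free_left_basis_def]] unfolding is_coord_def
    by (rule bspec) simp
  then have "\<gamma> h = \<gamma> h'"
    using \<gamma>_coord[of h] \<gamma>_coord[of h', folded eq] by blast
  then have "\<phi> (?cR (\<rho> h (c, d))) = \<phi> (?cR (\<rho> h' (c, d)))"
    by (simp add: \<gamma>_def fun_eq_iff)
  then have "?cR (\<rho> h (c, d)) = ?cR (\<rho> h' (c, d))"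
    by (rule inj_onD[OF inj]) simp_all
  then have "\<rho> h (c, d) - \<rho> h' (c, d) \<in> rel_ideal (R_rels F)"
    by (simp add: cls_eq_iff)
  also have "\<rho> h (c, d) - \<rho> h' (c, d) =
      (\<Sum>(a, b)\<in>A. scal (h a b c d - h' a b c d) * gen I1 ^ a * gen I2 ^ b)"
    using mem(2)
    by (simp add: \<rho>_def case_prod_beta scal_diff left_diff_distrib flip: sum_subtractf)
  finally have "h a b c d - h' a b c d = 0"
    by (rule R_monomials_independent) (use fin mem in auto)
  then show ?thesis by simp
qed

definition normal_sum :: "(nat \<Rightarrow> nat \<Rightarrow> nat \<Rightarrow> nat \<Rightarrow> 'k::field) \<Rightarrow> (var, 'k) free_alg" where
  "normal_sum h =
     Sum_any (\<lambda>(a, b, c, d). scal (h a b c d) * xv I1 ^ a * xv I2 ^ b * yv I1 ^ c * yv I2 ^ d)"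

lemma normal_sum_superset:
  assumes "finite A" "{(a, b, c, d). h a b c d \<noteq> 0} \<subseteq> A"
  shows "normal_sum h =
    (\<Sum>(a, b, c, d)\<in>A. scal (h a b c d) * xv I1 ^ a * xv I2 ^ b * yv I1 ^ c * yv I2 ^ d)"
  unfolding normal_sum_def using assms(1)
proof (rule Sum_any.expand_superset)
  show "{n. (case n of (a, b, c, d) \<Rightarrow>
      scal (h a b c d) * xv I1 ^ a * xv I2 ^ b * yv I1 ^ c * yv I2 ^ d) \<noteq> 0} \<subseteq> A"
  proof (clarify, rule ccontr)
    fix a b c d
    assume nz: "scal (h a b c d) * xv I1 ^ a * xv I2 ^ b * yv I1 ^ c * yv I2 ^ d \<noteq> 0"
      and "(a, b, c, d) \<notin> A"
    then have "h a b c d = 0" using assms(2) by blast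
    with nz show False by (simp add: scal_zero)
  qed
qed

lemma normal_sum_inj:
  fixes F :: "'k::field family"
  assumes adm: "admissible F"
    and fin: "finite {(a, b, c, d). h a b c d \<noteq> 0}" "finite {(a, b, c, d). h' a b c d \<noteq> 0}"
    and eq: "cls (B_rels F) (normal_sum h) = cls (B_rels F) (normal_sum h')"
  shows "h = h'"
proof (intro ext)
  fix a b c d
  \<comment> \<open>Inserting the point puts it into the common box even where both arrays
    vanish.\<close>
  let ?P = "insert (a, b, c, d) ({(a, b, c, d). h a b c d \<noteq> 0} \<union> {(a, b, c, d). h' a b c d \<noteq> 0})"
  define A where "A = (\<lambda>(a, b, c, d). (a, b)) ` ?P"
  define C where "C = (\<lambda>(a, b, c, d). (c, d)) ` ?P"
  \<comment> \<open>This box contains both supports. Its y-exponents come first, to become the outer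
    summation index that \<open>normal_sum_unique\<close> expects.\<close>
  let ?Q = "(\<lambda>((c, d), (a, b)). (a, b, c, d)) ` (C \<times> A)"
  have finP: "finite ?P" using fin by simp
  then have finAC: "finite A" "finite C"
    unfolding A_def C_def by (rule finite_imageI)+
  have sub: "?P \<subseteq> ?Q"
  proof
    fix n assume n: "n \<in> ?P"
    obtain a' b' c' d' where abcd: "n = (a', b', c', d')" by (cases n)
    have "(a', b') \<in> A" "(c', d') \<in> C"
      unfolding A_def C_def using n abcd by force+
    then show "n \<in> ?Q" unfolding abcd by force
  qed
  have sum: "normal_sum g = (\<Sum>(c, d)\<in>C. (\<Sum>(a, b)\<in>A. scal (g a b c d) * xv I1 ^ a * xv I2 ^ b)
                        * (yv I1 ^ c * yv I2 ^ d))"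
    if g: "{(a, b, c, d). g a b c d \<noteq> 0} \<subseteq> ?P" for g :: "nat \<Rightarrow> nat \<Rightarrow> nat \<Rightarrow> nat \<Rightarrow> 'k"
  proof -
    have "normal_sum g = (\<Sum>(a, b, c, d)\<in>?Q.
        scal (g a b c d) * xv I1 ^ a * xv I2 ^ b * yv I1 ^ c * yv I2 ^ d)"
      by (rule normal_sum_superset[OF _ subset_trans[OF g sub]]) (use finAC in simp)
    also have "\<dots> = (\<Sum>((c, d), (a, b))\<in>C \<times> A.
        scal (g a b c d) * xv I1 ^ a * xv I2 ^ b * yv I1 ^ c * yv I2 ^ d)"
      by (subst sum.reindex) (auto simp: inj_on_def case_prod_beta comp_def)
    also have "\<dots> = (\<Sum>(c, d)\<in>C. \<Sum>(a, b)\<in>A.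
        scal (g a b c d) * xv I1 ^ a * xv I2 ^ b * yv I1 ^ c * yv I2 ^ d)"
      by (simp add: case_prod_beta sum.cartesian_product)
    finally show ?thesis
      by (simp add: case_prod_beta sum_distrib_right mult.assoc)
  qed
  have "cls (B_rels F) (\<Sum>(c, d)\<in>C. (\<Sum>(a, b)\<in>A. scal (h a b c d) * xv I1 ^ a * xv I2 ^ b)
                        * (yv I1 ^ c * yv I2 ^ d)) =
        cls (B_rels F) (\<Sum>(c, d)\<in>C. (\<Sum>(a, b)\<in>A. scal (h' a b c d) * xv I1 ^ a * xv I2 ^ b)
                        * (yv I1 ^ c * yv I2 ^ d))"
    using eq by (subst (asm) (1 2) sum) blast+
  then show "h a b c d = h' a b c d"
    by (rule normal_sum_unique[OF adm finAC]) (simp_all add: A_def C_def)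
qed

text \<open>\<open>NF\<close> is a definite description, and \<open>normal_sum_inj\<close> makes the
  normal element of a given class unique, so any such element is its value.\<close>

lemma NF_eqI:
  fixes F :: "'k::field family"
  assumes "admissible F" and u: "u \<in> normal_span" and eq: "cls (B_rels F) u = cls (B_rels F) \<omega>"
  shows "NF F \<omega> = u"
  unfolding NF_def
proof (rule the_equality)
  fix v assume v: "v \<in> normal_span \<and> cls (B_rels F) v = cls (B_rels F) \<omega>"
  have span: "\<exists>h. w = normal_sum h \<and> finite {(a, b, c, d). h a b c d \<noteq> 0}"
    if "w \<in> normal_span" for w
    using that unfolding normal_span_def normal_sum_def by blast
  from span[OF u] obtain h where "u = normal_sum h" "finite {(a, b, c, d). h a b c d \<noteq> 0}"
    by blast
  moreover from span[of v] v obtain h'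
    where "v = normal_sum h'" "finite {(a, b, c, d). h' a b c d \<noteq> 0}"
    by blast
  ultimately show "v = u"
    using normal_sum_inj[OF assms(1), of h' h] eq v by simp
qed (use u eq in blast)

section \<open>Expansions of degree one in the \<open>y\<close>-generators\<close>

definition expansion :: "(nat \<Rightarrow> nat \<Rightarrow> idx \<Rightarrow> 'k::field) \<Rightarrow> (var, 'k) free_alg" where
  "expansion w = Sum_any (\<lambda>(\<alpha>, \<beta>, l). scal (w \<alpha> \<beta> l) * xv I1 ^ \<alpha> * xv I2 ^ \<beta> * yv l)"

lemma expansion_superset:
  assumes "finite A" "{(\<alpha>, \<beta>, l). w \<alpha> \<beta> l \<noteq> 0} \<subseteq> A"
  shows "expansion w = (\<Sum>(\<alpha>, \<beta>, l)\<in>A. scal (w \<alpha> \<beta> l) * xv I1 ^ \<alpha> * xv I2 ^ \<beta> * yv l)"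
  unfolding expansion_def using assms(1)
proof (rule Sum_any.expand_superset)
  show "{n. (case n of (\<alpha>, \<beta>, l) \<Rightarrow> scal (w \<alpha> \<beta> l) * xv I1 ^ \<alpha> * xv I2 ^ \<beta> * yv l) \<noteq> 0} \<subseteq> A"
  proof (clarify, rule ccontr)
    fix \<alpha> \<beta> l
    assume nz: "scal (w \<alpha> \<beta> l) * xv I1 ^ \<alpha> * xv I2 ^ \<beta> * yv l \<noteq> 0" and "(\<alpha>, \<beta>, l) \<notin> A"
    then have "w \<alpha> \<beta> l = 0" using assms(2) by blast
    with nz show False by (simp add: scal_zero)
  qed
qed

text \<open>Encodes the label of the y-generator as an exponent pair. An expansion of degree one in
  the y-generators becomes a special normal sum and inherits uniqueness from it.\<close>

definition y_coeffs :: "(nat \<Rightarrow> nat \<Rightarrow> idx \<Rightarrow> 'k::zero) \<Rightarrow> nat \<Rightarrow> nat \<Rightarrow> nat \<Rightarrow> nat \<Rightarrow> 'k" where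
  "y_coeffs w a b c d =
     (if (c, d) = (1, 0) then w a b I1 else if (c, d) = (0, 1) then w a b I2 else 0)"

lemma y_coeffs_inj: "y_coeffs w = y_coeffs w' \<Longrightarrow> w = w'"
proof (intro ext)
  fix \<alpha> \<beta> l assume "y_coeffs w = y_coeffs w'"
  then have "y_coeffs w \<alpha> \<beta> c d = y_coeffs w' \<alpha> \<beta> c d" for c d by simp
  from this[of 1 0] this[of 0 1] show "w \<alpha> \<beta> l = w' \<alpha> \<beta> l"
    by (cases l) (simp_all add: y_coeffs_def)
qed

lemma y_coeffs_support:
  "{(a, b, c, d). y_coeffs w a b c d \<noteq> 0} \<subseteq>
     (\<lambda>(\<alpha>, \<beta>, l). (\<alpha>, \<beta>, if l = I1 then (1, 0) else (0, 1))) ` {(\<alpha>, \<beta>, l). w \<alpha> \<beta> l \<noteq> 0}"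
proof clarify
  fix a b c d assume "y_coeffs w a b c d \<noteq> 0"
  then obtain l where "w a b l \<noteq> 0" "(c, d) = (if l = I1 then (1, 0) else (0, 1))"
    by (auto simp: y_coeffs_def split: if_splits)
  then show "(a, b, c, d) \<in> (\<lambda>(\<alpha>, \<beta>, l). (\<alpha>, \<beta>, if l = I1 then (1, 0) else (0, 1)))
      ` {(\<alpha>, \<beta>, l). w \<alpha> \<beta> l \<noteq> 0}"
    by (intro image_eqI[of _ _ "(a, b, l)"]) auto
qed

lemma finite_y_coeffs:
  "finite {(\<alpha>, \<beta>, l). w \<alpha> \<beta> l \<noteq> 0} \<Longrightarrow> finite {(a, b, c, d). y_coeffs w a b c d \<noteq> 0}"
  by (rule finite_subset[OF y_coeffs_support]) simp

lemma expansion_eq_normal_sum: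
  assumes "finite {(\<alpha>, \<beta>, l). w \<alpha> \<beta> l \<noteq> 0}"
  shows "expansion w = normal_sum (y_coeffs w)"
proof -
  let ?A = "{(\<alpha>, \<beta>, l). w \<alpha> \<beta> l \<noteq> 0}"
  let ?f = "\<lambda>(\<alpha>, \<beta>, l). (\<alpha>, \<beta>, if l = I1 then (1, 0) else (0, 1)) :: nat \<times> nat \<times> nat \<times> nat"
  have inj: "inj_on ?f ?A"
  proof (rule inj_onI)
    fix n n' assume eq: "?f n = ?f n'"
    obtain a b l where n: "n = (a, b, l)" by (cases n)
    obtain a' b' l' where n': "n' = (a', b', l')" by (cases n')
    from eq show "n = n'"
      unfolding n n' by (cases l; cases l') simp_all
  qed
  have "normal_sum (y_coeffs w) = (\<Sum>(a, b, c, d)\<in>?f ` ?A.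
      scal (y_coeffs w a b c d) * xv I1 ^ a * xv I2 ^ b * yv I1 ^ c * yv I2 ^ d)"
    using assms by (intro normal_sum_superset y_coeffs_support) simp
  also have "\<dots> = (\<Sum>(\<alpha>, \<beta>, l)\<in>?A. scal (w \<alpha> \<beta> l) * xv I1 ^ \<alpha> * xv I2 ^ \<beta> * yv l)"
    unfolding sum.reindex[OF inj]
  proof (intro sum.cong refl)
    fix n :: "nat \<times> nat \<times> idx"
    obtain \<alpha> \<beta> l where n: "n = (\<alpha>, \<beta>, l)" by (cases n)
    show "((\<lambda>(a, b, c, d). scal (y_coeffs w a b c d) * xv I1 ^ a * xv I2 ^ b * yv I1 ^ c * yv I2 ^ d)
        \<circ> ?f) n = (case n of (\<alpha>, \<beta>, l) \<Rightarrow> scal (w \<alpha> \<beta> l) * xv I1 ^ \<alpha> * xv I2 ^ \<beta> * yv l)"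
      unfolding n by (cases l) (simp_all add: y_coeffs_def)
  qed
  also have "\<dots> = expansion w"
    by (simp add: expansion_superset[OF assms])
  finally show ?thesis by simp
qed

lemma expansion_in_normal_span:
  assumes "finite {(\<alpha>, \<beta>, l). w \<alpha> \<beta> l \<noteq> 0}"
  shows "expansion w \<in> normal_span"
  unfolding expansion_eq_normal_sum[OF assms] normal_sum_def normal_span_def
  using finite_y_coeffs[OF assms] by blast

lemma expansion_inj:
  fixes F :: "'k::field family" and w w' :: "nat \<Rightarrow> nat \<Rightarrow> idx \<Rightarrow> 'k"
  assumes "admissible F"
    and fin: "finite {(\<alpha>, \<beta>, l). w \<alpha> \<beta> l \<noteq> 0}" "finite {(\<alpha>, \<beta>, l). w' \<alpha> \<beta> l \<noteq> 0}"
    and "expansion w = expansion w'"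
  shows "w = w'"
proof (rule y_coeffs_inj, rule normal_sum_inj[OF assms(1)])
  show "cls (B_rels F) (normal_sum (y_coeffs w)) = cls (B_rels F) (normal_sum (y_coeffs w'))"
    using assms(4) by (simp add: expansion_eq_normal_sum fin)
qed (use fin in \<open>auto intro!: finite_y_coeffs\<close>)

text \<open>Reduces the problem to exhibiting one finitely supported array that is correct modulo
  the relations: it fixes the normal form by \<open>NF_eqI\<close>, and \<open>expansion_inj\<close>
  recovers the array from it.\<close>

lemma is_expansion_iff:
  fixes F :: "'k::field family"
  assumes adm: "admissible F"
    and fin: "finite {(\<alpha>, \<beta>, l). w\<^sub>0 \<alpha> \<beta> l \<noteq> 0}"
    and eq: "cls (B_rels F) (expansion w\<^sub>0) = cls (B_rels F) (yv i * xv I1 ^ a * xv I2 ^ b)"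
  shows "is_expansion F i a b w \<longleftrightarrow> w = w\<^sub>0"
proof -
  have "NF F (yv i * xv I1 ^ a * xv I2 ^ b) = expansion w\<^sub>0"
    using adm expansion_in_normal_span[OF fin] eq by (rule NF_eqI)
  then have "is_expansion F i a b w \<longleftrightarrow>
      finite {(\<alpha>, \<beta>, l). w \<alpha> \<beta> l \<noteq> 0} \<and> expansion w\<^sub>0 = expansion w"
    by (simp add: is_expansion_def expansion_def)
  then show ?thesis
    using expansion_inj[OF adm fin, of w] fin by auto
qed

section \<open>The recursion step as an operator on coefficient arrays, and its support\<close>

definition w_step ::
    "'k::field family \<Rightarrow> idx \<Rightarrow> (nat \<Rightarrow> nat \<Rightarrow> idx \<Rightarrow> 'k) \<Rightarrow> nat \<Rightarrow> nat \<Rightarrow> idx \<Rightarrow> 'k" where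
  "w_step F \<epsilon> w \<alpha> \<beta> l =
     Sum_any (\<lambda>(\<mu>, \<nu>). \<Sum>j\<in>{I1, I2}. w \<mu> \<nu> j *
       (\<Sum>(c, t, l')\<in>{T \<in> mixed_terms F j \<epsilon>. snd (snd T) = l}. c * Omega F \<mu> \<nu> t \<alpha> \<beta>))"

lemma finite_mixed_terms: "finite (mixed_terms F i s)"
  by (cases F; cases i; cases s) simp_all

text \<open>Straightening preserves the total degree \<mu> + \<nu> + 1 and never lowers the exponent
  of the first generator. The bounds confine the support of \<open>w_step\<close> to a finite
  box.\<close>

lemma Omega_bound:
  assumes "Omega F \<mu> \<nu> t \<alpha> \<beta> \<noteq> 0"
  shows "\<alpha> \<le> \<mu> + \<nu> + 1 \<and> \<beta> \<le> \<nu> + 1"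
proof (rule ccontr)
  assume "\<not> (\<alpha> \<le> \<mu> + \<nu> + 1 \<and> \<beta> \<le> \<nu> + 1)"
  then have "Omega F \<mu> \<nu> t \<alpha> \<beta> = 0"
    by (cases t) (auto simp: Omega_def intro!: sum.neutral)
  with assms show False by simp
qed

lemma UNIV_idx: "(UNIV :: idx set) = {I1, I2}"
  using idx.exhaust by auto

lemma finite_idx_support_bounded:
  assumes "finite {(\<alpha>, \<beta>, l::idx). w \<alpha> \<beta> l \<noteq> 0}"
  obtains N :: nat where "{(\<alpha>, \<beta>, l). w \<alpha> \<beta> l \<noteq> 0} \<subseteq> {..N} \<times> {..N} \<times> {I1, I2}"
proof -
  let ?f = "\<lambda>(\<alpha>, \<beta>, l). \<alpha> + \<beta>"
  have "finite (?f ` {(\<alpha>, \<beta>, l). w \<alpha> \<beta> l \<noteq> 0})" using assms by simp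
  then obtain N where N: "?f ` {(\<alpha>, \<beta>, l). w \<alpha> \<beta> l \<noteq> 0} \<subseteq> {..N}"
    using finite_nat_set_iff_bounded_le by (metis atMost_iff subsetI)
  have "\<alpha> \<le> N \<and> \<beta> \<le> N" if "w \<alpha> \<beta> l \<noteq> 0" for \<alpha> \<beta> l
  proof -
    have "?f (\<alpha>, \<beta>, l) \<in> {..N}"
      using N that by blast
    then show ?thesis by simp
  qed
  then show thesis
    by (intro that[of N]) (auto simp flip: UNIV_idx)
qed

lemma w_step_superset:
  assumes "{(\<alpha>, \<beta>, l). w \<alpha> \<beta> l \<noteq> 0} \<subseteq> {..N} \<times> {..N} \<times> {I1, I2}"
  shows "w_step F \<epsilon> w \<alpha> \<beta> l =
    (\<Sum>(\<mu>, \<nu>, j)\<in>{..N} \<times> {..N} \<times> {I1, I2}. w \<mu> \<nu> j *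
       (\<Sum>(c, t, l')\<in>{T \<in> mixed_terms F j \<epsilon>. snd (snd T) = l}. c * Omega F \<mu> \<nu> t \<alpha> \<beta>))"
proof -
  let ?g = "\<lambda>\<mu> \<nu> j. w \<mu> \<nu> j *
       (\<Sum>(c, t, l')\<in>{T \<in> mixed_terms F j \<epsilon>. snd (snd T) = l}. c * Omega F \<mu> \<nu> t \<alpha> \<beta>)"
  have "w_step F \<epsilon> w \<alpha> \<beta> l = (\<Sum>(\<mu>, \<nu>)\<in>{..N} \<times> {..N}. \<Sum>j\<in>{I1, I2}. ?g \<mu> \<nu> j)"
    unfolding w_step_def
  proof (rule Sum_any.expand_superset)
    have z: "w \<mu> \<nu> j = 0" if "(\<mu>, \<nu>) \<notin> {..N} \<times> {..N}" for \<mu> \<nu> j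
      using assms that by blast
    show "{n. (case n of (\<mu>, \<nu>) \<Rightarrow> \<Sum>j\<in>{I1, I2}. ?g \<mu> \<nu> j) \<noteq> 0} \<subseteq> {..N} \<times> {..N}"
    proof (rule subsetI, rule ccontr)
      fix n
      assume n: "n \<in> {n. (case n of (\<mu>, \<nu>) \<Rightarrow> \<Sum>j\<in>{I1, I2}. ?g \<mu> \<nu> j) \<noteq> 0}"
        and notin: "n \<notin> {..N} \<times> {..N}"
      obtain \<mu> \<nu> where "n = (\<mu>, \<nu>)" by (cases n)
      with n notin show False using z[of \<mu> \<nu>] by simp
    qed
  qed simp
  also have "\<dots> = (\<Sum>\<mu>\<le>N. \<Sum>\<nu>\<le>N. \<Sum>j\<in>{I1, I2}. ?g \<mu> \<nu> j)"
    by (rule sum.cartesian_product[symmetric])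
  also have "\<dots> = (\<Sum>(\<mu>, \<nu>, j)\<in>{..N} \<times> {..N} \<times> {I1, I2}. ?g \<mu> \<nu> j)"
    by (simp only: sum.cartesian_product)
  finally show ?thesis .
qed

text \<open>A nonzero entry needs some nonzero \<open>Omega\<close> with \<mu> and \<nu> at most
  \<open>N\<close>. The side \<open>2 * N + 1\<close> is then the first bound of
  \<open>Omega_bound\<close>, taken for both exponents.\<close>

lemma w_step_support:
  assumes "{(\<alpha>, \<beta>, l). w \<alpha> \<beta> l \<noteq> 0} \<subseteq> {..N} \<times> {..N} \<times> {I1, I2}"
  shows "{(\<alpha>, \<beta>, l). w_step F \<epsilon> w \<alpha> \<beta> l \<noteq> 0} \<subseteq> {..2 * N + 1} \<times> {..2 * N + 1} \<times> {I1, I2}"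
proof (rule subsetI)
  fix n assume "n \<in> {(\<alpha>, \<beta>, l). w_step F \<epsilon> w \<alpha> \<beta> l \<noteq> 0}"
  then obtain \<alpha> \<beta> l where n: "n = (\<alpha>, \<beta>, l)" and nz: "w_step F \<epsilon> w \<alpha> \<beta> l \<noteq> 0" by blast
  have "\<exists>\<mu>\<le>N. \<exists>\<nu>\<le>N. \<exists>t. Omega F \<mu> \<nu> t \<alpha> \<beta> \<noteq> 0"
  proof (rule ccontr)
    assume "\<not> ?thesis"
    then have "w_step F \<epsilon> w \<alpha> \<beta> l = 0"
      unfolding w_step_superset[OF assms] by (intro sum.neutral) auto
    with nz show False ..
  qed
  then obtain \<mu> \<nu> t where "\<mu> \<le> N" "\<nu> \<le> N" "Omega F \<mu> \<nu> t \<alpha> \<beta> \<noteq> 0" by blast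
  with Omega_bound[of F \<mu> \<nu> t \<alpha> \<beta>] show "n \<in> {..2 * N + 1} \<times> {..2 * N + 1} \<times> {I1, I2}"
    by (simp add: n flip: UNIV_idx)
qed

lemma finite_w_step:
  assumes "finite {(\<alpha>, \<beta>, l). w \<alpha> \<beta> l \<noteq> 0}"
  shows "finite {(\<alpha>, \<beta>, l). w_step F \<epsilon> w \<alpha> \<beta> l \<noteq> 0}"
proof -
  from assms obtain N where "{(\<alpha>, \<beta>, l). w \<alpha> \<beta> l \<noteq> 0} \<subseteq> {..N} \<times> {..N} \<times> {I1, I2}"
    by (rule finite_idx_support_bounded)
  from w_step_support[OF this] show ?thesis
    by (rule finite_subset) simp
qed

section \<open>Right multiplication by an x-generator realises the recursion step\<close>

lemma scal_sum: "scal (sum f A) = (\<Sum>i\<in>A. scal (f i))"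
  by (induction A rule: infinite_finite_induct) (simp_all add: scal_zero scal_add)

lemma scal_commute: "scal c * u = u * scal c"
proof (induction u rule: poly_mapping_additive_induct)
  case (single k d)
  show ?case by (simp add: scal_def mult_single mult.commute)
qed (simp add: distrib_left distrib_right)

lemma scal_left_commute: "u * (scal c * v) = scal c * (u * v)"
  by (metis mult.assoc scal_commute)

text \<open>The interchange of sums behind the recursion. In its use \<open>n\<close> is a pair of
  x-exponents, \<open>l\<close> a y-label, \<open>p\<close> a triple (\<mu>, \<nu>, j) and
  \<open>T\<close> a term of a mixed relation. Each \<open>T\<close> has exactly one label and it
  lies in \<open>L\<close>, so summing the restricted sums over \<open>L\<close> gives the sum over
  all of \<open>K p\<close>.\<close>

lemma sum_regroup:
  fixes m :: "'n \<Rightarrow> ('g, 'k::field) free_alg" and y :: "'l \<Rightarrow> ('g, 'k) free_alg"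
  assumes "\<And>p. finite (K p)" "finite L" "\<And>p. lab ` K p \<subseteq> L"
  shows "(\<Sum>n\<in>Q. \<Sum>l\<in>L. scal (\<Sum>p\<in>P. W p * (\<Sum>T\<in>{T \<in> K p. lab T = l}. C T * Om p T n)) * (m n * y l)) =
    (\<Sum>p\<in>P. scal (W p) * (\<Sum>T\<in>K p. scal (C T) * ((\<Sum>n\<in>Q. scal (Om p T n) * m n) * y (lab T))))"
proof -
  define t where "t p T n = scal (W p) * (scal (C T) * (scal (Om p T n) * (m n * y (lab T))))" for p T n
  have "scal (\<Sum>p\<in>P. W p * (\<Sum>T\<in>{T \<in> K p. lab T = l}. C T * Om p T n)) * (m n * y l)
      = (\<Sum>p\<in>P. \<Sum>T\<in>{T \<in> K p. lab T = l}. t p T n)" for n l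
    by (simp add: scal_sum scal_mult sum_distrib_left sum_distrib_right t_def mult.assoc)
  then have "(\<Sum>n\<in>Q. \<Sum>l\<in>L. scal (\<Sum>p\<in>P. W p * (\<Sum>T\<in>{T \<in> K p. lab T = l}. C T * Om p T n)) * (m n * y l))
      = (\<Sum>n\<in>Q. \<Sum>l\<in>L. \<Sum>p\<in>P. \<Sum>T\<in>{T \<in> K p. lab T = l}. t p T n)"
    by simp
  also have "\<dots> = (\<Sum>n\<in>Q. \<Sum>p\<in>P. \<Sum>l\<in>L. \<Sum>T\<in>{T \<in> K p. lab T = l}. t p T n)"
    by (intro sum.cong refl sum.swap)
  also have "\<dots> = (\<Sum>n\<in>Q. \<Sum>p\<in>P. \<Sum>T\<in>K p. t p T n)"
    by (intro sum.cong refl sum.group assms)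
  also have "\<dots> = (\<Sum>p\<in>P. \<Sum>T\<in>K p. \<Sum>n\<in>Q. t p T n)"
    by (subst sum.swap) (intro sum.cong refl sum.swap)
  finally show ?thesis
    by (simp add: t_def sum_distrib_left sum_distrib_right mult.assoc)
qed

text \<open>The box depends on \<open>N\<close> alone, so all the straightenings in one recursion
  step share a single index set.\<close>

lemma Omega_expansion_box:
  assumes "\<mu> \<le> N" "\<nu> \<le> N"
  shows "xv I1 ^ \<mu> * xv I2 ^ \<nu> * xv t -
    (\<Sum>(\<alpha>, \<beta>)\<in>{..2 * N + 1} \<times> {..2 * N + 1}. scal (Omega F \<mu> \<nu> t \<alpha> \<beta>) * (xv I1 ^ \<alpha> * xv I2 ^ \<beta>))
    \<in> rel_ideal (B_rels F)"
proof -
  have "Sum_any (\<lambda>(\<alpha>, \<beta>). scal (Omega F \<mu> \<nu> t \<alpha> \<beta>) * xv I1 ^ \<alpha> * xv I2 ^ \<beta>) =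
    (\<Sum>(\<alpha>, \<beta>)\<in>{..2 * N + 1} \<times> {..2 * N + 1}. scal (Omega F \<mu> \<nu> t \<alpha> \<beta>) * xv I1 ^ \<alpha> * xv I2 ^ \<beta>)"
  proof (rule Sum_any.expand_superset)
    have z: "Omega F \<mu> \<nu> t \<alpha> \<beta> = 0" if "(\<alpha>, \<beta>) \<notin> {..2 * N + 1} \<times> {..2 * N + 1}" for \<alpha> \<beta>
      by (rule ccontr) (use Omega_bound[of F \<mu> \<nu> t \<alpha> \<beta>] assms that in auto)
    show "{n. (case n of (\<alpha>, \<beta>) \<Rightarrow> scal (Omega F \<mu> \<nu> t \<alpha> \<beta>) * xv I1 ^ \<alpha> * xv I2 ^ \<beta>) \<noteq> 0}
        \<subseteq> {..2 * N + 1} \<times> {..2 * N + 1}"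
    proof (rule subsetI, rule ccontr)
      fix n
      assume n: "n \<in> {n. (case n of (\<alpha>, \<beta>) \<Rightarrow> scal (Omega F \<mu> \<nu> t \<alpha> \<beta>) * xv I1 ^ \<alpha> * xv I2 ^ \<beta>) \<noteq> 0}"
        and notin: "n \<notin> {..2 * N + 1} \<times> {..2 * N + 1}"
      obtain \<alpha> \<beta> where "n = (\<alpha>, \<beta>)" by (cases n)
      with n notin show False using z[of \<alpha> \<beta>] by (simp add: scal_zero)
    qed
  qed simp
  with Omega_expansion[of F \<mu> \<nu> t] show ?thesis
    by (simp add: cls_eq_iff mult.assoc)
qed

text \<open>Both expressions are written as sums over the same index set \<open>P\<close> with the
  same scalars \<open>W p\<close>, so their difference can be put into the ideal summand by
  summand.\<close>

lemma w_step_expansion: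
  fixes F :: "'k::field family"
  assumes fin: "finite {(\<alpha>, \<beta>, l). w \<alpha> \<beta> l \<noteq> 0}"
  shows "expansion w * xv \<epsilon> - expansion (w_step F \<epsilon> w) \<in> rel_ideal (B_rels F)"
proof -
  let ?I = "rel_ideal (B_rels F)"
  from fin obtain N where N: "{(\<alpha>, \<beta>, l). w \<alpha> \<beta> l \<noteq> 0} \<subseteq> {..N} \<times> {..N} \<times> {I1, I2}"
    by (rule finite_idx_support_bounded)
  define P where "P = {..N} \<times> {..N} \<times> {I1, I2}"
  define Q where "Q = {..2 * N + 1} \<times> {..2 * N + 1}"
  define m :: "nat \<times> nat \<Rightarrow> (var, 'k) free_alg" where "m = (\<lambda>(\<alpha>, \<beta>). xv I1 ^ \<alpha> * xv I2 ^ \<beta>)"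
  define K where "K = (\<lambda>(\<mu> :: nat, \<nu> :: nat, j). mixed_terms F j \<epsilon>)"
  define W where "W = (\<lambda>(\<mu>, \<nu>, j). w \<mu> \<nu> j)"
  define Om where "Om = (\<lambda>(\<mu>, \<nu>, j :: idx) (c :: 'k, t, l' :: idx) (\<alpha>, \<beta>). Omega F \<mu> \<nu> t \<alpha> \<beta>)"
  \<comment> \<open>For \<open>p\<close> = (\<mu>, \<nu>, j) and \<open>T\<close> = (c, t, l) this
    is the straightened form of \<open>xv I1 ^ \<mu> * xv I2 ^ \<nu> * xv t * yv l\<close>.\<close>
  define G where "G = (\<lambda>p T. (\<Sum>n\<in>Q. scal (Om p T n) * m n) * yv (snd (snd T)))"
  have finK: "finite (K p)" for p
    by (cases p) (simp add: K_def finite_mixed_terms)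

  have "expansion (w_step F \<epsilon> w) =
      (\<Sum>(\<alpha>, \<beta>, l)\<in>{..2 * N + 1} \<times> {..2 * N + 1} \<times> {I1, I2}.
        scal (w_step F \<epsilon> w \<alpha> \<beta> l) * xv I1 ^ \<alpha> * xv I2 ^ \<beta> * yv l)"
    by (rule expansion_superset[OF _ w_step_support[OF N]]) simp
  also have "\<dots> = (\<Sum>(\<alpha>, \<beta>)\<in>Q. \<Sum>l\<in>{I1, I2}. scal (w_step F \<epsilon> w \<alpha> \<beta> l) * (m (\<alpha>, \<beta>) * yv l))"
    unfolding Q_def m_def by (simp only: sum.cartesian_product[symmetric] mult.assoc prod.case)
  also have "\<dots> = (\<Sum>n\<in>Q. \<Sum>l\<in>{I1, I2}.
      scal (\<Sum>p\<in>P. W p * (\<Sum>T\<in>{T \<in> K p. snd (snd T) = l}. fst T * Om p T n)) * (m n * yv l))"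
    unfolding w_step_superset[OF N] P_def W_def K_def Om_def
    by (simp only: case_prod_unfold prod.collapse)
  also have "\<dots> = (\<Sum>p\<in>P. scal (W p) * (\<Sum>T\<in>K p. scal (fst T) * G p T))"
    unfolding G_def by (rule sum_regroup, rule finK, simp, simp flip: UNIV_idx)
  finally have rhs: "expansion (w_step F \<epsilon> w) = (\<Sum>p\<in>P. scal (W p) * (\<Sum>T\<in>K p. scal (fst T) * G p T))" .

  have "expansion w = (\<Sum>(\<alpha>, \<beta>, l)\<in>P. scal (w \<alpha> \<beta> l) * xv I1 ^ \<alpha> * xv I2 ^ \<beta> * yv l)"
    unfolding P_def by (rule expansion_superset[OF _ N]) simp
  then have lhs: "expansion w * xv \<epsilon> =
      (\<Sum>p\<in>P. scal (W p) * (m (fst p, fst (snd p)) * (yv (snd (snd p)) * xv \<epsilon>)))"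
    by (simp add: W_def m_def case_prod_beta sum_distrib_right mult.assoc)

  \<comment> \<open>Two reductions are chained: fact 1 moves the x-generator past
    \<open>yv j\<close> by the mixed relation, and fact 2 straightens the resulting x-part.\<close>
  have "m (fst p, fst (snd p)) * (yv (snd (snd p)) * xv \<epsilon>) - (\<Sum>T\<in>K p. scal (fst T) * G p T) \<in> ?I"
    if "p \<in> P" for p
  proof -
    obtain \<mu> \<nu> j where p: "p = (\<mu>, \<nu>, j)" by (cases p)
    have le: "\<mu> \<le> N" "\<nu> \<le> N" using that p by (auto simp: P_def)
    have "yv j * xv \<epsilon> - (\<Sum>(c, t, l)\<in>mixed_terms F j \<epsilon>. scal c * xv t * yv l) \<in> ?I"
      by (rule subsetD[OF rel_ideal_incl]) (auto simp: B_rels_def)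
    from rel_ideal_lmult[OF this, of "m (\<mu>, \<nu>)"]
    have 1: "m (\<mu>, \<nu>) * (yv j * xv \<epsilon>)
        - (\<Sum>T\<in>mixed_terms F j \<epsilon>. scal (fst T) * (m (\<mu>, \<nu>) * xv (fst (snd T)) * yv (snd (snd T)))) \<in> ?I"
      by (simp add: right_diff_distrib sum_distrib_left case_prod_beta scal_left_commute mult.assoc)
    have "scal (fst T) * ((m (\<mu>, \<nu>) * xv (fst (snd T)) - (\<Sum>n\<in>Q. scal (Om p T n) * m n)) * yv (snd (snd T))) \<in> ?I"
      for T
      using Omega_expansion_box[OF le, of "fst (snd T)" F]
      by (intro rel_ideal_lmult rel_ideal_rmult) (simp add: p Om_def m_def Q_def case_prod_beta)
    then have "(\<Sum>T\<in>mixed_terms F j \<epsilon>. scal (fst T) *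
        ((m (\<mu>, \<nu>) * xv (fst (snd T)) - (\<Sum>n\<in>Q. scal (Om p T n) * m n)) * yv (snd (snd T)))) \<in> ?I"
      by (rule rel_ideal_sum)
    then have 2: "(\<Sum>T\<in>mixed_terms F j \<epsilon>. scal (fst T) * (m (\<mu>, \<nu>) * xv (fst (snd T)) * yv (snd (snd T))))
        - (\<Sum>T\<in>mixed_terms F j \<epsilon>. scal (fst T) * G p T) \<in> ?I"
      by (simp only: G_def left_diff_distrib right_diff_distrib sum_subtractf)
    from rel_ideal_minus_trans[OF 1 2] show ?thesis
      by (simp add: p K_def)
  qed
  then have "(\<Sum>p\<in>P. scal (W p) * (m (fst p, fst (snd p)) * (yv (snd (snd p)) * xv \<epsilon>)
      - (\<Sum>T\<in>K p. scal (fst T) * G p T))) \<in> ?I"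
    by (intro rel_ideal_sum rel_ideal_lmult)
  then show ?thesis
    unfolding lhs rhs by (simp only: right_diff_distrib sum_subtractf)
qed

section \<open>The coefficients produced by the recursion\<close>

fun W_coeff :: "'k::field family \<Rightarrow> idx \<Rightarrow> nat \<Rightarrow> nat \<Rightarrow> nat \<Rightarrow> nat \<Rightarrow> idx \<Rightarrow> 'k" where
  "W_coeff F i 0 0 = (\<lambda>\<alpha> \<beta> l. of_bool (\<alpha> = 0 \<and> \<beta> = 0 \<and> l = i))"
| "W_coeff F i a (Suc b) = w_step F I2 (W_coeff F i a b)"
| "W_coeff F i (Suc a) 0 = w_step F I1 (W_coeff F i a 0)"

text \<open>The recursion removes the last letter of the x-monomial, which is \<open>xv I2\<close>
  as long as \<open>b > 0\<close>; multiplying the shorter expansion by that letter on the right is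
  \<open>w_step_expansion\<close>. Finiteness is carried along because that lemma assumes
  it.\<close>

lemma W_coeff_expansion:
  fixes F :: "'k::field family"
  shows "finite {(\<alpha>, \<beta>, l). W_coeff F i a b \<alpha> \<beta> l \<noteq> 0} \<and>
    expansion (W_coeff F i a b) - yv i * xv I1 ^ a * xv I2 ^ b \<in> rel_ideal (B_rels F)"
proof (induction F i a b rule: W_coeff.induct)
  case (1 F i)
  have sub: "{(\<alpha>, \<beta>, l). W_coeff F i 0 0 \<alpha> \<beta> l \<noteq> 0} \<subseteq> {(0, 0, i)}"
    by auto
  have "expansion (W_coeff F i 0 0) = yv i"
    using expansion_superset[OF _ sub] by (simp add: scal_one)
  with finite_subset[OF sub] show ?case by (simp add: rel_ideal_zero)
next
  case (2 F i a b)
  let ?w = "W_coeff F i a b"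
  have "expansion (w_step F I2 ?w) - expansion ?w * xv I2 \<in> rel_ideal (B_rels F)"
    using rel_ideal_uminus[OF w_step_expansion[of ?w I2 F]] 2 by simp
  moreover have "expansion ?w * xv I2 - yv i * xv I1 ^ a * xv I2 ^ Suc b \<in> rel_ideal (B_rels F)"
    using rel_ideal_rmult[OF conjunct2[OF 2], of "xv I2"]
    by (simp add: left_diff_distrib mult.assoc power_commutes)
  ultimately show ?case
    using 2 finite_w_step[of ?w F I2] by (simp add: rel_ideal_minus_trans del: power_Suc)
next
  case (3 F i a)
  let ?w = "W_coeff F i a 0"
  have "expansion (w_step F I1 ?w) - expansion ?w * xv I1 \<in> rel_ideal (B_rels F)"
    using rel_ideal_uminus[OF w_step_expansion[of ?w I1 F]] 3 by simp
  moreover have "expansion ?w * xv I1 - yv i * xv I1 ^ Suc a \<in> rel_ideal (B_rels F)"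
    using rel_ideal_rmult[OF conjunct2[OF 3], of "xv I1"]
    by (simp add: left_diff_distrib mult.assoc power_commutes)
  ultimately show ?case
    using 3 finite_w_step[of ?w F I1] by (simp add: rel_ideal_minus_trans del: power_Suc)
qed

lemma is_expansion_iff_W_coeff:
  "admissible F \<Longrightarrow> is_expansion F i a b w \<longleftrightarrow> w = W_coeff F i a b"
  using W_coeff_expansion[of F i a b] by (intro is_expansion_iff) (simp_all add: cls_eq_iff)

lemma W_coeff_recursion:
  assumes "(a, b) \<noteq> (0, 0)"
  shows "W_coeff F i a b =
    (let (a', b', \<epsilon>) = (if b > 0 then (a, b - 1, I2) else (a - 1, 0, I1)) in w_step F \<epsilon> (W_coeff F i a' b'))"
  using assms by (cases b; cases a) simp_all

text \<open>The recursion lowers \<open>b\<close> with \<open>a\<close> fixed, and lowers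
  \<open>a\<close> only at \<open>b = 0\<close>. Hence the outer induction on \<open>b\<close>, with
  an induction on \<open>a\<close> inside its base case.\<close>

lemma W_coeff_unique:
  assumes init: "\<And>i l. W i 0 0 0 0 l = of_bool (i = l)"
      "\<And>i \<alpha> \<beta> l. (\<alpha>, \<beta>) \<noteq> (0, 0) \<Longrightarrow> W i 0 0 \<alpha> \<beta> l = 0"
    and rec: "\<And>i a b. (a, b) \<noteq> (0, 0) \<Longrightarrow> W i a b =
      (let (a', b', \<epsilon>) = (if b > 0 then (a, b - 1, I2) else (a - 1, 0, I1)) in w_step F \<epsilon> (W i a' b'))"
  shows "W i a b = W_coeff F i a b"
proof (induction b)
  case 0
  show ?case
  proof (induction a)
    case 0
    show ?case
    proof (intro ext)
      fix \<alpha> \<beta> l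
      show "W i 0 0 \<alpha> \<beta> l = W_coeff F i 0 0 \<alpha> \<beta> l"
        using init by (cases "(\<alpha>, \<beta>) = (0, 0)") auto
    qed
  next
    case (Suc a)
    then show ?case using rec[of "Suc a" 0 i] by simp
  qed
next
  case (Suc b)
  then show ?case using rec[of a "Suc b" i] by simp
qed

theorem proposition3p6:
  fixes F :: "'k::{alg_closed_field, field_char_0} family"
  assumes "admissible F"
  shows
    "(\<forall>i a b. \<exists>!w. is_expansion F i a b w) \<and>
     (\<forall>W. (\<forall>i a b. is_expansion F i a b (W i a b)) \<longleftrightarrow>
        (\<forall>i. (\<forall>l. W i 0 0 0 0 l = of_bool (i = l)) \<and>
             (\<forall>\<alpha> \<beta> l. (\<alpha>, \<beta>) \<noteq> (0, 0) \<longrightarrow> W i 0 0 \<alpha> \<beta> l = 0)) \<and>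
        (\<forall>i a b. (a, b) \<noteq> (0, 0) \<longrightarrow>
           (let (a', b', \<epsilon>) = (if b > 0 then (a, b - 1, I2) else (a - 1, 0, I1)) in
            \<forall>\<alpha> \<beta> l. W i a b \<alpha> \<beta> l =
              Sum_any (\<lambda>(\<mu>, \<nu>). \<Sum>j\<in>{I1, I2}. W i a' b' \<mu> \<nu> j *
                (\<Sum>(c, t, l')\<in>{T \<in> mixed_terms F j \<epsilon>. snd (snd T) = l}. c * Omega F \<mu> \<nu> t \<alpha> \<beta>)))))"
proof (intro conjI allI)
  show "\<exists>!w. is_expansion F i a b w" for i a b
    by (simp add: is_expansion_iff_W_coeff[OF assms])
next
  fix W :: "idx \<Rightarrow> nat \<Rightarrow> nat \<Rightarrow> nat \<Rightarrow> nat \<Rightarrow> idx \<Rightarrow> 'k"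
  let ?init = "\<forall>i. (\<forall>l. W i 0 0 0 0 l = of_bool (i = l)) \<and>
             (\<forall>\<alpha> \<beta> l. (\<alpha>, \<beta>) \<noteq> (0, 0) \<longrightarrow> W i 0 0 \<alpha> \<beta> l = 0)"
  let ?rec = "\<forall>i a b. (a, b) \<noteq> (0, 0) \<longrightarrow>
           (let (a', b', \<epsilon>) = (if b > 0 then (a, b - 1, I2) else (a - 1, 0, I1)) in
            \<forall>\<alpha> \<beta> l. W i a b \<alpha> \<beta> l =
              Sum_any (\<lambda>(\<mu>, \<nu>). \<Sum>j\<in>{I1, I2}. W i a' b' \<mu> \<nu> j *
                (\<Sum>(c, t, l')\<in>{T \<in> mixed_terms F j \<epsilon>. snd (snd T) = l}. c * Omega F \<mu> \<nu> t \<alpha> \<beta>)))"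
  let ?rec' = "\<forall>i a b. (a, b) \<noteq> (0, 0) \<longrightarrow> W i a b =
      (let (a', b', \<epsilon>) = (if b > 0 then (a, b - 1, I2) else (a - 1, 0, I1)) in w_step F \<epsilon> (W i a' b'))"
  \<comment> \<open>The recursion of the statement is entrywise; \<open>w_step\<close> packs it into
    an equation between arrays.\<close>
  have rec: "?rec \<longleftrightarrow> ?rec'"
    unfolding fun_eq_iff w_step_def by (simp add: Let_def)
  \<comment> \<open>Since being an expansion means being equal to \<open>W_coeff\<close>, it remains
    to characterise \<open>W_coeff\<close> by the initial values and the recursion.\<close>
  have "(\<forall>i a b. W i a b = W_coeff F i a b) \<longleftrightarrow> ?init \<and> ?rec'"
  proof
    assume "\<forall>i a b. W i a b = W_coeff F i a b"
    then have "W = W_coeff F" by (simp add: fun_eq_iff)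
    then show "?init \<and> ?rec'"
      by (auto simp: W_coeff_recursion)
  next
    assume "?init \<and> ?rec'"
    then show "\<forall>i a b. W i a b = W_coeff F i a b"
      by (intro allI W_coeff_unique) blast+
  qed
  then show "(\<forall>i a b. is_expansion F i a b (W i a b)) \<longleftrightarrow> ?init \<and> ?rec"
    unfolding rec by (simp only: is_expansion_iff_W_coeff[OF assms])
qed

end
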